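(* Let $0<\mu_1<\mu_2$, $\alpha\in(0,1)$, $H>0$, $\delta\ge0$, $\sigma\in(0,1/2)$. Set $$\mu_3:=\frac{\mu_1\min\{1,\mu_1\}}{2\mu_2^2},\qquad \mu_5:=\frac{H}{16\,\mu_2^{(1+\alpha)/2}}.$$ Let $\{\lambda_i\}$ be a sequence of positive reals with $\lambda_i\to+\infty$. Then the set of all $c\in\mathcal{PS}(\mu_1,\mu_2,\alpha,H)$ that are universal activators for $\{\lambda_i\}$ with order $(\mu_3,\mu_5)$ is residual in $\mathcal{PS}(\mu_1,\mu_2,\alpha,H)$ (with respect to the uniform distance).
   Context: $\mathcal{PS}(\mu_1,\mu_2,\alpha,H)$ is the set of functions $c:[0,+\infty)\to[0,+\infty)$ with $\mu_1\le c(t)\le\mu_2$ for all $t\ge 0$ and $|c(t)-c(s)|\le H|t-s|^\alpha$ for all $t,s\ge0$, a complete metric space with the uniform distance; residual means containing a countable intersection of open dense sets. Universal activator: given $\alpha,\delta,\sigma$, a sequence $\{\lambda_i\}$ of positive reals and positive reals $\mu_3,\mu_5$, a continuous $c:[0,+\infty)\to\mathbb{R}$ is a universal activator for $\{\lambda_i\}$ with order $(\mu_3,\mu_5)$ if the solutions $w_i$ of $w_i''(t)+2\delta\lambda_i^{2\sigma}w_i'(t)+\lambda_i^2c(t)w_i(t)=0$, $w_i(0)=0$, $w_i'(0)=1$ satisfy $$\limsup_{i\to+\infty}\big(|w_i'(t)|^2+\lambda_i^2|w_i(t)|^2\big)\exp\big(-\mu_5\lambda_i^{1-\alpha}t+2\delta\lambda_i^{2\sigma}t\big)\ge\mu_3\qquad\forall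 t\ge0.$$ *)

theory Defs
  imports "HOL-Analysis.Analysis" "HOL-Library.Liminf_Limsup"
begin

text \<open>Functions on [0,+inf) are represented as functions real => real that are
  identically 0 on the negative reals (canonical representative).\<close>

definition PS :: "real \<Rightarrow> real \<Rightarrow> real \<Rightarrow> real \<Rightarrow> (real \<Rightarrow> real) set" where
  "PS \<mu>1 \<mu>2 \<alpha> H = {c. (\<forall>t\<ge>0. \<mu>1 \<le> c t \<and> c t \<le> \<mu>2)
      \<and> (\<forall>t\<ge>0. \<forall>s\<ge>0. \<bar>c t - c s\<bar> \<le> H * \<bar>t - s\<bar> powr \<alpha>)
      \<and> (\<forall>t<0. c t = 0)}"

definition udist :: "(real \<Rightarrow> real) \<Rightarrow> (real \<Rightarrow> real) \<Rightarrow> real" where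
  "udist c1 c2 = (SUP t\<in>{0..}. \<bar>c1 t - c2 t\<bar>)"

definition open_in_space :: "(real \<Rightarrow> real) set \<Rightarrow> (real \<Rightarrow> real) set \<Rightarrow> bool" where
  "open_in_space X U \<longleftrightarrow> U \<subseteq> X \<and>
     (\<forall>c\<in>U. \<exists>\<epsilon>>0. \<forall>c'\<in>X. udist c c' < \<epsilon> \<longrightarrow> c' \<in> U)"

definition dense_in_space :: "(real \<Rightarrow> real) set \<Rightarrow> (real \<Rightarrow> real) set \<Rightarrow> bool" where
  "dense_in_space X U \<longleftrightarrow> U \<subseteq> X \<and> (\<forall>c\<in>X. \<forall>\<epsilon>>0. \<exists>c'\<in>U. udist c c' < \<epsilon>)"

definition residual_in :: "(real \<Rightarrow> real) set \<Rightarrow> (real \<Rightarrow> real) set \<Rightarrow> bool" where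
  "residual_in X A \<longleftrightarrow> (\<exists>U :: nat \<Rightarrow> (real \<Rightarrow> real) set.
     (\<forall>n. open_in_space X (U n) \<and> dense_in_space X (U n)) \<and> (\<Inter>n. U n) \<subseteq> A)"

definition is_solution ::
  "real \<Rightarrow> real \<Rightarrow> (real \<Rightarrow> real) \<Rightarrow> real \<Rightarrow> (real \<Rightarrow> real) \<Rightarrow> (real \<Rightarrow> real) \<Rightarrow> bool" where
  "is_solution \<delta> \<sigma> c lam w w' \<longleftrightarrow>
     (\<forall>t\<ge>0. (w has_real_derivative w' t) (at t within {0..}) \<and>
        (w' has_real_derivative (- 2 * \<delta> * lam powr (2 * \<sigma>) * w' t - lam\<^sup>2 * c t * w t))
          (at t within {0..}))
     \<and> w 0 = 0 \<and> w' 0 = 1"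

definition universal_activator ::
  "real \<Rightarrow> real \<Rightarrow> real \<Rightarrow> (nat \<Rightarrow> real) \<Rightarrow> real \<Rightarrow> real \<Rightarrow> (real \<Rightarrow> real) \<Rightarrow> bool" where
  "universal_activator \<alpha> \<delta> \<sigma> lam \<mu>3 \<mu>5 c \<longleftrightarrow>
     continuous_on {0..} c \<and>
     (\<forall>w w' :: nat \<Rightarrow> real \<Rightarrow> real. (\<forall>i. is_solution \<delta> \<sigma> c (lam i) (w i) (w' i)) \<longrightarrow>
       (\<forall>t\<ge>0. Limsup sequentially (\<lambda>i. ereal
          ((\<bar>w' i t\<bar>\<^sup>2 + (lam i)\<^sup>2 * \<bar>w i t\<bar>\<^sup>2) *
           exp (- \<mu>5 * lam i powr (1 - \<alpha>) * t + 2 * \<delta> * lam i powr (2 * \<sigma>) * t)))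
         \<ge> ereal \<mu>3))"

end

theory Submission
  imports Defs "HOL-Real_Asymp.Real_Asymp"
begin

text \<open>
  Parametric resonance along the whole half-line. Let \<open>c\<close> be smooth with values strictly inside
  \<open>[\<mu>1, \<mu>2]\<close>, let \<open>\<psi> = sqrt c\<close>, \<open>q = \<psi>' / (2 \<psi>)\<close>, \<open>\<phi>' = \<lambda> \<psi>\<close>, \<open>b = \<delta> \<lambda> powr (2 \<sigma>)\<close> and
  \<open>K = k \<lambda> powr (1 - \<alpha>)\<close>. A multiple of \<open>w = \<psi> powr (- 1/2) exp (- b t + K \<integral> sin\<^sup>2 \<phi>) sin \<phi>\<close> solves
  the equation with coefficient
  \<open>c + (b/\<lambda>)\<^sup>2 - 2 (K/\<lambda>) \<psi> sin (2\<phi>) + (q' - (K sin\<^sup>2 \<phi> - q)\<^sup>2) / \<lambda>\<^sup>2\<close>,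
  and its energy grows like \<open>exp (k \<lambda> powr (1 - \<alpha>) t - 2 b t)\<close>. The perturbation has size
  \<open>\<lambda> powr (- \<alpha>)\<close> and slope \<open>\<lambda> powr (1 - \<alpha>)\<close>; interpolating, the choice \<open>k = 3/2 \<mu>5\<close> leaves its
  Hoelder constant below \<open>3/4 H\<close>, while \<open>k > \<mu>5\<close> makes the normalised energy exceed any bound on
  \<open>[1/n, n]\<close> for large \<open>\<lambda>\<close>. Smooth \<open>c\<close> are dense, and solutions depend continuously on the
  coefficient, so a neighbourhood of the perturbed coefficient inherits the energy bound. The dense
  open sets of the theorem are interiors, so no existence theorem for the equation is needed.
\<close>

subsection \<open>Smooth approximation with control of the Hoelder constant\<close>

lemma continuous_antiderivative:
  fixes f :: "real \<Rightarrow> real"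
  assumes "continuous_on UNIV f"
  obtains F where "F 0 = 0" "\<And>t. (F has_real_derivative f t) (at t)"
proof -
  define F where "F = (\<lambda>u. LBINT y=0..ereal u. f y)"
  have "(F has_real_derivative f t) (at t)" for t
  proof -
    \<comment> \<open>This interval contains the base point 0 and has \<open>t\<close> in its
      interior, so the derivative within it is the full derivative.\<close>
    have "(F has_vector_derivative f t) (at t within {-\<bar>t\<bar>-1..\<bar>t\<bar>+1})"
      unfolding F_def zero_ereal_def
      by (rule interval_integral_FTC2) (auto intro: continuous_on_subset[OF assms])
    moreover have "at t within {-\<bar>t\<bar>-1..\<bar>t\<bar>+1} = at t"
      by (rule at_within_interior) auto
    ultimately show ?thesis
      by (simp add: has_real_derivative_iff_has_vector_derivative)
  qed
  moreover have "F 0 = 0" by (simp add: F_def flip: zero_ereal_def)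
  ultimately show ?thesis using that by blast
qed

lemma holder_imp_continuous_on:
  fixes f :: "real \<Rightarrow> real"
  assumes "0 < \<alpha>" and "\<And>t s. t \<in> S \<Longrightarrow> s \<in> S \<Longrightarrow> \<bar>f t - f s\<bar> \<le> H * \<bar>t - s\<bar> powr \<alpha>"
  shows "continuous_on S f"
  unfolding continuous_on_def
proof
  fix x assume x: "x \<in> S"
  have "((\<lambda>t. H * \<bar>t - x\<bar> powr \<alpha>) \<longlongrightarrow> H * \<bar>x - x\<bar> powr \<alpha>) (at x within S)"
    using assms(1) by (intro tendsto_intros) auto
  then have "((\<lambda>t. H * \<bar>t - x\<bar> powr \<alpha>) \<longlongrightarrow> 0) (at x within S)" using assms(1) by simp
  then have "((\<lambda>t. f t - f x) \<longlongrightarrow> 0) (at x within S)"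
    by (rule Lim_null_comparison[rotated])
       (auto simp: eventually_at_filter x assms(2))
  then show "(f \<longlongrightarrow> f x) (at x within S)" by (simp add: LIM_zero_iff)
qed

text \<open>\<open>g\<close> is the mean of \<open>f\<close> over [t, t + h]. Averaging gains one
  derivative, and since means are values of \<open>f\<close> and differences of means are
  differences of values, neither the range nor the Hoelder constant gets worse.\<close>

lemma forward_average:
  fixes f :: "real \<Rightarrow> real"
  assumes "0 < \<alpha>" "0 \<le> H" "0 < h" "\<And>t. a \<le> f t" "\<And>t. f t \<le> b"
    and holder: "\<And>t s. \<bar>f t - f s\<bar> \<le> H * \<bar>t - s\<bar> powr \<alpha>"
  obtains g where "\<And>t. (g has_real_derivative (f (t + h) - f t) / h) (at t)"
    "\<And>t. a \<le> g t" "\<And>t. g t \<le> b"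
    "\<And>t s. \<bar>g t - g s\<bar> \<le> H * \<bar>t - s\<bar> powr \<alpha>"
    "\<And>t. \<bar>g t - f t\<bar> \<le> H * h powr \<alpha>"
proof -
  have "continuous_on UNIV f" by (rule holder_imp_continuous_on[OF assms(1) holder])
  then obtain F where F: "\<And>t. (F has_real_derivative f t) (at t)"
    by (rule continuous_antiderivative) blast
  define g where "g = (\<lambda>t. (F (t + h) - F t) / h)"
  have mvt: "\<exists>x. t < x \<and> x < t + h \<and> g t = f x" for t
  proof -
    have "\<exists>x. t < x \<and> x < t + h \<and> F (t + h) - F t = (t + h - t) * f x"
      by (rule MVT2) (use assms(3) F in auto)
    then show ?thesis using assms(3) by (auto simp: g_def)
  qed
  show ?thesis
  proof
    fix t
    have "((\<lambda>x. F (x + h)) has_real_derivative f (t + h)) (at t)"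
      using F[of "t + h"] by (simp add: DERIV_shift)
    then show "(g has_real_derivative (f (t + h) - f t) / h) (at t)"
      unfolding g_def by (intro DERIV_cdivide DERIV_diff F)
    obtain x where x: "t < x" "x < t + h" "g t = f x" using mvt by blast
    then show "a \<le> g t" "g t \<le> b" using assms(4,5) by auto
    have "\<bar>g t - f t\<bar> \<le> H * \<bar>x - t\<bar> powr \<alpha>" using holder[of x t] x by simp
    also have "\<dots> \<le> H * h powr \<alpha>"
      using x assms(1-3) by (intro mult_left_mono powr_mono2) auto
    finally show "\<bar>g t - f t\<bar> \<le> H * h powr \<alpha>" .
    fix s
    \<comment> \<open>The mean value theorem for the difference of two shifted antiderivatives
      yields one offset common to \<open>t\<close> and \<open>s\<close>; separate offsets would
      spoil the Hoelder constant.\<close>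
    have "\<exists>x. 0 < x \<and> x < h \<and> (F (h + t) - F (h + s)) - (F (0 + t) - F (0 + s)) = (h - 0) * (f (x + t) - f (x + s))"
    proof (rule MVT2)
      show "0 < h" by fact
      fix x
      show "((\<lambda>x. F (x + t) - F (x + s)) has_real_derivative f (x + t) - f (x + s)) (at x)"
        by (intro DERIV_diff) (use F in \<open>simp_all flip: DERIV_shift\<close>)
    qed
    then obtain y where "(F (t + h) - F (s + h)) - (F t - F s) = h * (f (t + y) - f (s + y))"
      by (auto simp: add.commute)
    then have "g t - g s = f (t + y) - f (s + y)"
      using assms(3) unfolding g_def diff_divide_distrib[symmetric]
      by (simp add: divide_eq_eq) (simp add: algebra_simps)
    then show "\<bar>g t - g s\<bar> \<le> H * \<bar>t - s\<bar> powr \<alpha>" using holder[of "t + y" "s + y"] by simp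
  qed
qed

text \<open>Three successive forward averages. The difference quotient \<open>D\<close> commutes
  with differentiation and turns a bound \<open>C\<close> into \<open>2 * C / h\<close>, which
  bounds all three derivatives. The third one enters through the second derivative of
  \<open>q\<close> in \<open>smooth_profile\<close>.\<close>

lemma smooth_approximation:
  fixes f :: "real \<Rightarrow> real"
  assumes "0 < \<alpha>" "0 \<le> H" "0 < h" "\<And>t. a \<le> f t" "\<And>t. f t \<le> b"
    and holder: "\<And>t s. \<bar>f t - f s\<bar> \<le> H * \<bar>t - s\<bar> powr \<alpha>"
  obtains g g1 g2 g3 B where
    "\<And>t. (g has_real_derivative g1 t) (at t)" "\<And>t. (g1 has_real_derivative g2 t) (at t)"
    "\<And>t. (g2 has_real_derivative g3 t) (at t)"
    "\<And>t. \<bar>g1 t\<bar> \<le> B" "\<And>t. \<bar>g2 t\<bar> \<le> B" "\<And>t. \<bar>g3 t\<bar> \<le> B"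
    "\<And>t. a \<le> g t" "\<And>t. g t \<le> b"
    "\<And>t s. \<bar>g t - g s\<bar> \<le> H * \<bar>t - s\<bar> powr \<alpha>"
    "\<And>t. \<bar>g t - f t\<bar> \<le> 3 * H * h powr \<alpha>"
proof -
  define D where "D = (\<lambda>(u::real \<Rightarrow> real) t. (u (t + h) - u t) / h)"
  have D_deriv: "(D u has_real_derivative D u' t) (at t)"
    if "\<And>t. (u has_real_derivative u' t) (at t)" for u u' t
    unfolding D_def using that[of "t + h"] that[of t]
    by (intro DERIV_cdivide DERIV_diff) (simp_all add: DERIV_shift)
  have D_bound: "\<bar>D u t\<bar> \<le> 2 * C / h" if "\<And>t. \<bar>u t\<bar> \<le> C" for u C t
    using that[of "t + h"] that[of t] assms(3) by (simp add: D_def divide_right_mono)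
  obtain u where u: "\<And>t. (u has_real_derivative D f t) (at t)" "\<And>t. a \<le> u t" "\<And>t. u t \<le> b"
    "\<And>t s. \<bar>u t - u s\<bar> \<le> H * \<bar>t - s\<bar> powr \<alpha>" "\<And>t. \<bar>u t - f t\<bar> \<le> H * h powr \<alpha>"
    unfolding D_def by (rule forward_average[OF assms]) auto
  obtain v where v: "\<And>t. (v has_real_derivative D u t) (at t)" "\<And>t. a \<le> v t" "\<And>t. v t \<le> b"
    "\<And>t s. \<bar>v t - v s\<bar> \<le> H * \<bar>t - s\<bar> powr \<alpha>" "\<And>t. \<bar>v t - u t\<bar> \<le> H * h powr \<alpha>"
    unfolding D_def by (rule forward_average[OF assms(1-3) u(2-4)]) auto
  obtain g where g: "\<And>t. (g has_real_derivative D v t) (at t)" "\<And>t. a \<le> g t" "\<And>t. g t \<le> b"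
    "\<And>t s. \<bar>g t - g s\<bar> \<le> H * \<bar>t - s\<bar> powr \<alpha>" "\<And>t. \<bar>g t - v t\<bar> \<le> H * h powr \<alpha>"
    unfolding D_def by (rule forward_average[OF assms(1-3) v(2-4)]) auto
  define C where "C = \<bar>a\<bar> + \<bar>b\<bar>"
  have C: "\<bar>f t\<bar> \<le> C" "\<bar>u t\<bar> \<le> C" "\<bar>v t\<bar> \<le> C" for t
    using assms(4,5)[of t] u(2,3)[of t] v(2,3)[of t] by (auto simp: C_def)
  define B where "B = max (2 * C / h) (max (2 * (2 * C / h) / h) (2 * (2 * (2 * C / h) / h) / h))"
  show ?thesis
  proof (rule that[of g "D v" "D (D u)" "D (D (D f))" B])
    fix t s
    show "(g has_real_derivative D v t) (at t)" by (rule g)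
    show "(D v has_real_derivative D (D u) t) (at t)" by (intro D_deriv v)
    show "(D (D u) has_real_derivative D (D (D f)) t) (at t)" by (intro D_deriv u)
    have "\<bar>D v t\<bar> \<le> 2 * C / h" "\<bar>D (D u) t\<bar> \<le> 2 * (2 * C / h) / h"
      "\<bar>D (D (D f)) t\<bar> \<le> 2 * (2 * (2 * C / h) / h) / h"
      by (intro D_bound C)+
    then show "\<bar>D v t\<bar> \<le> B" "\<bar>D (D u) t\<bar> \<le> B" "\<bar>D (D (D f)) t\<bar> \<le> B"
      unfolding B_def by linarith+
    show "a \<le> g t" "g t \<le> b" "\<bar>g t - g s\<bar> \<le> H * \<bar>t - s\<bar> powr \<alpha>" by (rule g)+
    show "\<bar>g t - f t\<bar> \<le> 3 * H * h powr \<alpha>"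
      using u(5)[of t] v(5)[of t] g(5)[of t] by linarith
  qed
qed

text \<open>A smooth approximant is contracted by a factor \<theta> < 1 towards the midpoint of
  [\<mu>1, \<mu>2]. This leaves a margin \<kappa> at both ends of the range and lowers the Hoelder
  constant to \<open>\<theta> * H\<close>: the room that the resonant perturbation will use.\<close>

lemma smooth_profile:
  assumes "0 < \<mu>1" "\<mu>1 < \<mu>2" "0 < \<alpha>" "0 < H" "0 < \<epsilon>" and c0: "c0 \<in> PS \<mu>1 \<mu>2 \<alpha> H"
  obtains \<psi> q q1 q2 :: "real \<Rightarrow> real" and M \<theta> \<kappa> :: real where
    "\<And>t. (\<psi> has_real_derivative 2 * q t * \<psi> t) (at t)"
    "\<And>t. (q has_real_derivative q1 t) (at t)" "\<And>t. (q1 has_real_derivative q2 t) (at t)"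
    "0 < \<kappa>" "\<theta> < 1" "0 < M"
    "\<And>t. sqrt \<mu>1 \<le> \<psi> t" "\<And>t. \<psi> t \<le> sqrt \<mu>2"
    "\<And>t. \<mu>1 + \<kappa> \<le> (\<psi> t)\<^sup>2" "\<And>t. (\<psi> t)\<^sup>2 \<le> \<mu>2 - \<kappa>"
    "\<And>t. \<bar>q t\<bar> \<le> M" "\<And>t. \<bar>q1 t\<bar> \<le> M" "\<And>t. \<bar>q2 t\<bar> \<le> M"
    "\<And>t s. \<bar>(\<psi> t)\<^sup>2 - (\<psi> s)\<^sup>2\<bar> \<le> \<theta> * H * \<bar>t - s\<bar> powr \<alpha>"
    "\<And>t. 0 \<le> t \<Longrightarrow> \<bar>c0 t - (\<psi> t)\<^sup>2\<bar> < \<epsilon>"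
proof -
  \<comment> \<open>Solves \<open>H * h powr \<alpha> = \<epsilon> / 8\<close>.\<close>
  define h where "h = (\<epsilon> / (8 * H)) powr (1 / \<alpha>)"
  have h: "0 < h" "3 * H * h powr \<alpha> = 3 * \<epsilon> / 8"
    using assms by (simp_all add: h_def powr_powr)
  \<comment> \<open>Constant extension to negative times keeps the Hoelder bound because
    \<open>max 0\<close> is 1-Lipschitz; \<open>c0\<close> itself jumps to 0 there.\<close>
  define f where "f = (\<lambda>t. c0 (max 0 t))"
  have f_range: "\<mu>1 \<le> f t" "f t \<le> \<mu>2" for t using c0 by (auto simp: f_def PS_def)
  have f_holder: "\<bar>f t - f s\<bar> \<le> H * \<bar>t - s\<bar> powr \<alpha>" for t s
  proof -
    have "\<bar>f t - f s\<bar> \<le> H * \<bar>max 0 t - max 0 s\<bar> powr \<alpha>"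
      using c0 unfolding f_def PS_def by auto
    also have "\<dots> \<le> H * \<bar>t - s\<bar> powr \<alpha>"
      using assms by (intro mult_left_mono powr_mono2) auto
    finally show ?thesis .
  qed
  obtain g g1 g2 g3 B where g_deriv: "\<And>t. (g has_real_derivative g1 t) (at t)"
      "\<And>t. (g1 has_real_derivative g2 t) (at t)" "\<And>t. (g2 has_real_derivative g3 t) (at t)"
    and g_bound: "\<And>t. \<bar>g1 t\<bar> \<le> B" "\<And>t. \<bar>g2 t\<bar> \<le> B" "\<And>t. \<bar>g3 t\<bar> \<le> B"
    and g_range: "\<And>t. \<mu>1 \<le> g t" "\<And>t. g t \<le> \<mu>2"
    and g_holder: "\<And>t s. \<bar>g t - g s\<bar> \<le> H * \<bar>t - s\<bar> powr \<alpha>"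
    and g_close: "\<And>t. \<bar>g t - f t\<bar> \<le> 3 * H * h powr \<alpha>"
    using smooth_approximation[of \<alpha> H h \<mu>1 f \<mu>2, OF assms(3) less_imp_le[OF assms(4)] h(1) f_range f_holder]
    by blast
  \<comment> \<open>The quotient limits the displacement by the contraction to \<epsilon>/4, on top
    of 3\<epsilon>/8 from smoothing; the cap 1/2 keeps \<theta> positive.\<close>
  define \<theta> where "\<theta> = 1 - min (1/2) (\<epsilon> / (4 * (\<mu>2 - \<mu>1)))"
  have \<theta>: "0 < \<theta>" "\<theta> < 1" using assms by (auto simp: \<theta>_def)
  have "1 - \<theta> \<le> \<epsilon> / (4 * (\<mu>2 - \<mu>1))" by (simp add: \<theta>_def)
  then have "(1 - \<theta>) * (4 * (\<mu>2 - \<mu>1)) \<le> \<epsilon>"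
    using pos_le_divide_eq[of "4 * (\<mu>2 - \<mu>1)"] assms(2) by simp
  then have \<theta>_small: "(1 - \<theta>) * (\<mu>2 - \<mu>1) \<le> \<epsilon> / 4" by linarith
  define n where "n = (\<mu>1 + \<mu>2) / 2"
  define c where "c = (\<lambda>t. n + \<theta> * (g t - n))"
  define \<kappa> where "\<kappa> = (1 - \<theta>) * ((\<mu>2 - \<mu>1) / 2)"
  have \<kappa>: "0 < \<kappa>" using \<theta> assms by (simp add: \<kappa>_def)
  have c_range: "\<mu>1 + \<kappa> \<le> c t" "c t \<le> \<mu>2 - \<kappa>" for t
  proof -
    have "\<theta> * (\<mu>1 - n) \<le> \<theta> * (g t - n)" "\<theta> * (g t - n) \<le> \<theta> * (\<mu>2 - n)"
      using \<theta> g_range[of t] by (auto intro: mult_left_mono)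
    then show "\<mu>1 + \<kappa> \<le> c t" "c t \<le> \<mu>2 - \<kappa>"
      by (auto simp: c_def \<kappa>_def n_def field_simps)
  qed
  have c_lower: "\<mu>1 \<le> c t" for t using c_range[of t] \<kappa> by linarith
  have c_pos: "0 < c t" for t using c_lower[of t] assms by linarith
  have c_deriv: "(c has_real_derivative \<theta> * g1 t) (at t)" for t
    unfolding c_def by (auto intro!: derivative_eq_intros g_deriv)
  \<comment> \<open>For \<psi> = sqrt c, the quotient \<psi>' / (2 \<psi>) equals c' / (4 c). The
    formulas for \<open>q1\<close> and \<open>q2\<close> follow from c' = 4 q c.\<close>
  define q where "q = (\<lambda>t. \<theta> * g1 t / (4 * c t))"
  define q1 where "q1 = (\<lambda>t. \<theta> * g2 t / (4 * c t) - 4 * (q t)\<^sup>2)"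
  define q2 where "q2 = (\<lambda>t. \<theta> * g3 t / (4 * c t) - \<theta> * g2 t / (4 * c t) * (4 * q t) - 8 * q t * q1 t)"
  have c_deriv': "(c has_real_derivative 4 * q t * c t) (at t)" for t
    using c_deriv[of t] c_pos[of t] by (simp add: q_def)
  have quot: "((\<lambda>t. \<theta> * u t / (4 * c t)) has_real_derivative \<theta> * u' t / (4 * c t) - \<theta> * u t / (4 * c t) * (4 * q t)) (at t)"
    if "(u has_real_derivative u' t) (at t)" for u u' t
    using c_pos[of t]
    by (auto intro!: derivative_eq_intros that c_deriv' simp: field_simps)
  have q_deriv: "(q has_real_derivative q1 t) (at t)" for t
    using quot[of g1 g2 t, OF g_deriv(2)] by (simp add: q_def q1_def power2_eq_square mult_ac)
  have q1_deriv: "(q1 has_real_derivative q2 t) (at t)" for t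
    unfolding q1_def[abs_def] q2_def
    by (rule derivative_eq_intros quot g_deriv q_deriv refl | simp)+ (simp add: q1_def)
  have B: "0 \<le> B" using g_bound(1)[of 0] by linarith
  define B1 where "B1 = B / (4 * \<mu>1)"
  have B1: "0 \<le> B1" using B assms by (simp add: B1_def)
  have quot_bound: "\<bar>\<theta> * x / (4 * c t)\<bar> \<le> B1" if "\<bar>x\<bar> \<le> B" for x t
  proof -
    have "\<bar>\<theta> * x\<bar> \<le> 1 * B" unfolding abs_mult using that \<theta> by (intro mult_mono) auto
    then have "\<bar>\<theta> * x\<bar> / \<bar>4 * c t\<bar> \<le> B / (4 * \<mu>1)"
      using c_lower[of t] assms by (intro frac_le) auto
    then show ?thesis by (simp add: B1_def)
  qed
  have qb: "\<bar>q t\<bar> \<le> B1" for t unfolding q_def by (intro quot_bound g_bound)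
  have q1b: "\<bar>q1 t\<bar> \<le> B1 + 4 * B1\<^sup>2" for t
  proof -
    have "\<bar>q t\<bar>\<^sup>2 \<le> B1\<^sup>2" by (intro power_mono qb) auto
    then show ?thesis
      using quot_bound[OF g_bound(2), of t t] zero_le_power2[of "q t"] unfolding q1_def power2_abs by linarith
  qed
  have q2b: "\<bar>q2 t\<bar> \<le> B1 + B1 * (4 * B1) + 8 * B1 * (B1 + 4 * B1\<^sup>2)" for t
  proof -
    have "\<bar>\<theta> * g2 t / (4 * c t) * (4 * q t)\<bar> \<le> B1 * (4 * B1)"
      unfolding abs_mult[of _ "4 * q t"] using qb[of t] B1
      by (intro mult_mono quot_bound g_bound) auto
    moreover have "\<bar>8 * q t * q1 t\<bar> \<le> 8 * B1 * (B1 + 4 * B1\<^sup>2)"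
      unfolding abs_mult[of _ "q1 t"] using qb[of t] B1
      by (intro mult_mono q1b) auto
    ultimately show ?thesis
      using quot_bound[OF g_bound(3), of t t] unfolding q2_def by linarith
  qed
  define M where "M = max 1 (max B1 (max (B1 + 4 * B1\<^sup>2) (B1 + B1 * (4 * B1) + 8 * B1 * (B1 + 4 * B1\<^sup>2))))"
  define \<psi> where "\<psi> = (\<lambda>t. sqrt (c t))"
  have psi2: "(\<psi> t)\<^sup>2 = c t" for t using c_pos[of t] by (simp add: \<psi>_def)
  show ?thesis
  proof (rule that[of \<psi> q q1 q2 \<kappa> \<theta> M])
    fix t s :: real
    have "sqrt (c t) * sqrt (c t) = c t" using c_pos[of t] by simp
    then show "(\<psi> has_real_derivative 2 * q t * \<psi> t) (at t)"
      unfolding \<psi>_def using c_pos[of t]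
      by (auto intro!: derivative_eq_intros c_deriv' simp: field_simps)
    show "(q has_real_derivative q1 t) (at t)" "(q1 has_real_derivative q2 t) (at t)"
      by (rule q_deriv q1_deriv)+
    show "0 < \<kappa>" "\<theta> < 1" "0 < M" using \<kappa> \<theta> by (auto simp: M_def)
    show "sqrt \<mu>1 \<le> \<psi> t" "\<psi> t \<le> sqrt \<mu>2" using c_range[of t] \<kappa> by (auto simp: \<psi>_def)
    show "\<mu>1 + \<kappa> \<le> (\<psi> t)\<^sup>2" "(\<psi> t)\<^sup>2 \<le> \<mu>2 - \<kappa>" using c_range[of t] by (auto simp: psi2)
    show "\<bar>q t\<bar> \<le> M" "\<bar>q1 t\<bar> \<le> M" "\<bar>q2 t\<bar> \<le> M"
      using qb[of t] q1b[of t] q2b[of t] unfolding M_def by linarith+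
    have "\<bar>c t - c s\<bar> = \<theta> * \<bar>g t - g s\<bar>"
      using \<theta> by (simp add: c_def abs_mult flip: right_diff_distrib)
    also have "\<dots> \<le> \<theta> * (H * \<bar>t - s\<bar> powr \<alpha>)" using \<theta> by (intro mult_left_mono g_holder) auto
    finally show "\<bar>(\<psi> t)\<^sup>2 - (\<psi> s)\<^sup>2\<bar> \<le> \<theta> * H * \<bar>t - s\<bar> powr \<alpha>" by (simp add: psi2 mult.assoc)
    assume t: "0 \<le> t"
    have "\<bar>g t - c t\<bar> = (1 - \<theta>) * \<bar>g t - n\<bar>"
    proof -
      have "g t - c t = (1 - \<theta>) * (g t - n)" by (simp add: c_def algebra_simps)
      then show ?thesis using \<theta> by (simp add: abs_mult)
    qed
    also have "\<dots> \<le> (1 - \<theta>) * (\<mu>2 - \<mu>1)"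
    proof (rule mult_left_mono)
      show "\<bar>g t - n\<bar> \<le> \<mu>2 - \<mu>1" using g_range[of t] assms(2) unfolding n_def by (simp add: abs_le_iff field_simps)
    qed (use \<theta> in auto)
    finally have "\<bar>g t - c t\<bar> \<le> \<epsilon> / 4" using \<theta>_small by linarith
    moreover have "\<bar>g t - c0 t\<bar> \<le> 3 * \<epsilon> / 8" using g_close[of t] t h(2) by (simp add: f_def)
    ultimately show "\<bar>c0 t - (\<psi> t)\<^sup>2\<bar> < \<epsilon>" unfolding psi2 using assms(5) by linarith
  qed
qed

section \<open>Hoelder constants from sup and Lipschitz bounds\<close>

text \<open>In the factorisation of \<open>\<bar>x\<bar>\<close> into its powers
  \<open>1 - \<alpha>\<close> and \<open>\<alpha>\<close>, the first factor takes the sup bound and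
  the second the Lipschitz bound.\<close>

lemma holder_interpolation:
  fixes x :: real
  assumes "0 < \<alpha>" "\<alpha> < 1" "\<bar>x\<bar> \<le> A" "\<bar>x\<bar> \<le> B * d" "0 \<le> A" "0 \<le> B" "0 \<le> d"
  shows "\<bar>x\<bar> \<le> A powr (1 - \<alpha>) * B powr \<alpha> * d powr \<alpha>"
proof -
  have "\<bar>x\<bar> = \<bar>x\<bar> powr (1 - \<alpha>) * \<bar>x\<bar> powr \<alpha>" using powr_add[of "\<bar>x\<bar>" "1 - \<alpha>" \<alpha>] by simp
  also have "\<dots> \<le> A powr (1 - \<alpha>) * (B * d) powr \<alpha>"
    using assms by (intro mult_mono powr_mono2) auto
  finally show ?thesis using assms by (simp add: powr_mult mult.assoc)
qed

text \<open>Small increments of \<open>c\<close> are negligible by the Lipschitz bound, large increments of \<open>p\<close>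
  by the sup bound; so the Hoelder constants of \<open>c\<close> and \<open>p\<close> do not add up.\<close>

lemma holder_perturbation:
  fixes c p :: "real \<Rightarrow> real"
  assumes "0 < \<alpha>" "\<alpha> < 1" "0 < H" "0 \<le> A" "0 \<le> B" "0 \<le> L" "0 < \<eta>"
    and holder: "\<bar>c t - c u\<bar> \<le> \<theta> * H * \<bar>t - u\<bar> powr \<alpha>"
    and lip: "\<bar>c t - c u\<bar> \<le> L * \<bar>t - u\<bar>"
    and sup: "\<bar>p t\<bar> \<le> A" "\<bar>p u\<bar> \<le> A" and lip': "\<bar>p t - p u\<bar> \<le> B * \<bar>t - u\<bar>"
    and osc: "(2 * A) powr (1 - \<alpha>) * B powr \<alpha> \<le> 3 / 4 * H"
    and large: "2 * A \<le> (1 - \<theta>) * H * \<eta> powr \<alpha>" and small: "L * \<eta> powr (1 - \<alpha>) \<le> H / 4"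
    and \<theta>: "\<theta> < 1"
  shows "\<bar>(c t + p t) - (c u + p u)\<bar> \<le> H * \<bar>t - u\<bar> powr \<alpha>"
proof -
  define d where "d = \<bar>t - u\<bar>"
  have p2: "\<bar>p t - p u\<bar> \<le> 2 * A" using sup by linarith
  show ?thesis
  \<comment> \<open>Up to distance \<eta> the constant \<open>H\<close> is shared as 1/4 for
    \<open>c\<close> and 3/4 for \<open>p\<close>, beyond it as \<theta> and 1 - \<theta>.\<close>
  proof (cases "d \<le> \<eta>")
    case True
    have "\<bar>c t - c u\<bar> \<le> L * (d powr (1 - \<alpha>) * d powr \<alpha>)"
      using lip by (simp add: d_def flip: powr_add)
    also have "\<dots> \<le> L * (\<eta> powr (1 - \<alpha>) * d powr \<alpha>)"
      using True assms by (intro mult_left_mono mult_right_mono powr_mono2) (auto simp: d_def)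
    also have "\<dots> \<le> H / 4 * d powr \<alpha>"
      using mult_right_mono[OF small, of "d powr \<alpha>"] by (simp add: mult.assoc)
    finally have "\<bar>c t - c u\<bar> \<le> H / 4 * d powr \<alpha>" .
    moreover have "\<bar>p t - p u\<bar> \<le> (2 * A) powr (1 - \<alpha>) * B powr \<alpha> * d powr \<alpha>"
      using assms p2 by (intro holder_interpolation) (auto simp: d_def)
    then have "\<bar>p t - p u\<bar> \<le> 3 / 4 * H * d powr \<alpha>"
      using mult_right_mono[OF osc, of "d powr \<alpha>"] by simp
    ultimately show ?thesis unfolding d_def by linarith
  next
    case False
    have "(1 - \<theta>) * H * \<eta> powr \<alpha> \<le> (1 - \<theta>) * H * d powr \<alpha>"
      using False assms by (intro mult_left_mono powr_mono2) auto
    then have "\<bar>p t - p u\<bar> \<le> (1 - \<theta>) * H * d powr \<alpha>" using p2 large by linarith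
    moreover have "\<theta> * H * d powr \<alpha> + (1 - \<theta>) * H * d powr \<alpha> = H * d powr \<alpha>" by (simp add: algebra_simps)
    ultimately show ?thesis using holder unfolding d_def by linarith
  qed
qed

subsection \<open>An explicit resonant solution\<close>

text \<open>\<open>q\<close> is half the logarithmic derivative of \<psi>, so
  \<open>\<psi> powr (- 1/2)\<close> has logarithmic derivative \<open>- q\<close>. Here
  \<open>K\<close> and \<open>b\<close> are independent of \<open>l\<close>; the interpretation ties
  them to powers of \<open>l\<close>.\<close>

locale parametric_resonance =
  fixes \<psi> q q1 q2 \<phi> J :: "real \<Rightarrow> real" and l K b m s M :: real
  assumes psi_deriv: "(\<psi> has_real_derivative 2 * q t * \<psi> t) (at t)"
    and q_deriv: "(q has_real_derivative q1 t) (at t)"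
    and q1_deriv: "(q1 has_real_derivative q2 t) (at t)"
    and phi_deriv: "(\<phi> has_real_derivative l * \<psi> t) (at t)"
    and J_deriv: "(J has_real_derivative (sin (\<phi> t))\<^sup>2) (at t)"
    and phi_0: "\<phi> 0 = 0" and J_0: "J 0 = 0"
    and pos: "0 < m" "0 < l" "0 \<le> K" "0 \<le> b"
    and psi_lower: "m \<le> \<psi> t" and psi_upper: "\<psi> t \<le> s"
    and q_bound: "\<bar>q t\<bar> \<le> M" and q1_bound: "\<bar>q1 t\<bar> \<le> M" and q2_bound: "\<bar>q2 t\<bar> \<le> M"
begin

text \<open>The first term oscillates at twice the phase and pumps energy into the solution; the
  second collects the remainder that makes the ansatz an exact solution.\<close>

definition perturbation :: "real \<Rightarrow> real" where
  "perturbation t = - 2 * K / l * (\<psi> t * sin (2 * \<phi> t)) + (q1 t - (K * (sin (\<phi> t))\<^sup>2 - q t)\<^sup>2) / l\<^sup>2"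

text \<open>The term \<open>(b / l)\<^sup>2\<close> offsets the shift of the coefficient caused by
  the factor exp (- b t). It is constant in time and cancels in Hoelder increments.\<close>

definition coeff :: "real \<Rightarrow> real" where
  "coeff t = (\<psi> t)\<^sup>2 + (b / l)\<^sup>2 + perturbation t"

text \<open>Equals exp (- b t + K J) / (l sqrt (\<psi> t \<psi> 0)). The logarithms make it a single
  exponential, and \<psi> 0 normalises the initial slope of \<open>sol\<close> to 1.\<close>

definition ampl :: "real \<Rightarrow> real" where
  "ampl t = exp (- b * t + K * J t - (ln (\<psi> t) + ln (\<psi> 0)) / 2) / l"

definition sol :: "real \<Rightarrow> real" where
  "sol t = ampl t * sin (\<phi> t)"

definition sol' :: "real \<Rightarrow> real" where
  "sol' t = ampl t * ((K * (sin (\<phi> t))\<^sup>2 - b - q t) * sin (\<phi> t) + l * \<psi> t * cos (\<phi> t))"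

lemma psi_pos: "0 < \<psi> t" using psi_lower[of t] pos by linarith

lemma s_pos: "0 < s" using psi_pos[of 0] psi_upper[of 0] by linarith

lemma M_nonneg: "0 \<le> M" using q_bound[of 0] by linarith

lemma ampl_deriv:
  "(ampl has_real_derivative ampl t * (K * (sin (\<phi> t))\<^sup>2 - b - q t)) (at t)"
proof -
  have "((\<lambda>t. - b * t + K * J t - (ln (\<psi> t) + ln (\<psi> 0)) / 2) has_real_derivative
      - b + K * (sin (\<phi> t))\<^sup>2 - q t) (at t)"
    using psi_pos[of t] by (auto intro!: derivative_eq_intros J_deriv psi_deriv)
  from DERIV_cdivide[OF DERIV_fun_exp[OF this], of l] show ?thesis
    unfolding ampl_def by (rule DERIV_cong) (simp add: algebra_simps)
qed

lemma sol_deriv: "(sol has_real_derivative sol' t) (at t)"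
proof -
  note ampl_deriv[derivative_intros] phi_deriv[derivative_intros]
  show ?thesis
    unfolding sol_def sol'_def
    by (rule derivative_eq_intros refl | simp)+ (simp add: algebra_simps)
qed

text \<open>The cosine terms of the second derivative are 2 l \<psi> (h + q) cos \<phi>, with
  \<open>h\<close> the logarithmic derivative of \<open>ampl\<close>. The factor
  \<open>\<psi> powr (- 1/2)\<close> cancels \<open>q\<close>, leaving the damping and a term with
  sin\<phi> squared, which merges into the coefficient of sin \<phi>.\<close>

lemma sol'_deriv: "(sol' has_real_derivative - 2 * b * sol' t - l\<^sup>2 * coeff t * sol t) (at t)"
proof -
  note ampl_deriv[derivative_intros] phi_deriv[derivative_intros] psi_deriv[derivative_intros]
    q_deriv[derivative_intros]
  define h where "h = K * (sin (\<phi> t))\<^sup>2 - b - q t"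
  have "(sol' has_real_derivative
      ampl t * (h * (h * sin (\<phi> t) + l * \<psi> t * cos (\<phi> t))
       + ((2 * K * sin (\<phi> t) * cos (\<phi> t) * (l * \<psi> t) - q1 t) * sin (\<phi> t) + h * (cos (\<phi> t) * (l * \<psi> t))
       + l * (2 * q t * \<psi> t) * cos (\<phi> t) - l * \<psi> t * (sin (\<phi> t) * (l * \<psi> t))))) (at t)"
    unfolding sol'_def h_def
    by (rule derivative_eq_intros refl | simp)+ (simp add: algebra_simps)
  moreover have "l\<^sup>2 * coeff t = l\<^sup>2 * (\<psi> t)\<^sup>2 + b\<^sup>2 - 4 * K * l * \<psi> t * sin (\<phi> t) * cos (\<phi> t) + q1 t - (h + b)\<^sup>2"
    unfolding coeff_def perturbation_def h_def sin_double using pos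
    by (simp add: power2_eq_square field_simps)
  \<comment> \<open>Eliminating \<open>q t\<close> in favour of \<open>h\<close> leaves a polynomial
    identity.\<close>
  moreover have "q t = K * (sin (\<phi> t))\<^sup>2 - b - h" by (simp add: h_def)
  ultimately show ?thesis
    by (elim DERIV_cong) (simp add: sol_def sol'_def, simp add: algebra_simps power2_eq_square)
qed

lemma sol_init: "sol 0 = 0" "sol' 0 = 1"
  using psi_pos[of 0] pos by (simp_all add: sol_def sol'_def ampl_def phi_0 J_0 exp_minus)

lemma sol_is_solution:
  assumes b: "b = \<delta> * l powr (2 * \<sigma>)" and c: "\<And>t. 0 \<le> t \<Longrightarrow> c t = coeff t"
  shows "is_solution \<delta> \<sigma> c l sol sol'"
  unfolding is_solution_def
proof (intro conjI allI impI)
  fix t :: real assume t: "0 \<le> t"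
  show "(sol has_real_derivative sol' t) (at t within {0..})"
    by (rule has_field_derivative_at_within[OF sol_deriv])
  show "(sol' has_real_derivative - 2 * \<delta> * l powr (2 * \<sigma>) * sol' t - l\<^sup>2 * c t * sol t)
      (at t within {0..})"
    by (rule DERIV_cong[OF has_field_derivative_at_within[OF sol'_deriv]])
      (simp only: b c[OF t] mult.assoc)
qed (rule sol_init)+

text \<open>The hypothesis makes the slow part of the derivative so small that it costs at most half
  of the sine part of the energy, while half of the cosine part survives. The squared amplitude
  contributes the exponential and 1 / (\<psi> t \<psi> 0), which is at least
  \<open>1 / s\<^sup>2\<close>.\<close>

lemma energy_lower:
  assumes "(K + M + b)\<^sup>2 \<le> l\<^sup>2 / 2"
  shows "min 1 (m\<^sup>2) / (2 * s\<^sup>2) * exp (2 * K * J t) \<le> ((sol' t)\<^sup>2 + l\<^sup>2 * (sol t)\<^sup>2) * exp (2 * b * t)"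
proof -
  define y where "y = K * (sin (\<phi> t))\<^sup>2 - b - q t"
  define S C where "S = (sin (\<phi> t))\<^sup>2" and "C = (cos (\<phi> t))\<^sup>2"
  have SC: "0 \<le> S" "0 \<le> C" "S + C = 1" by (auto simp: S_def C_def)
  have "0 \<le> K * S" "K * S \<le> K" using SC pos by (auto intro: mult_left_le)
  then have "\<bar>y\<bar> \<le> K + M + b" using q_bound[of t] pos unfolding y_def S_def[symmetric] by linarith
  then have "y\<^sup>2 \<le> (K + M + b)\<^sup>2" by (metis abs_ge_zero power2_abs power_mono)
  then have y: "y\<^sup>2 \<le> l\<^sup>2 / 2" using assms by linarith
  have "m\<^sup>2 \<le> (\<psi> t)\<^sup>2" using psi_lower[of t] pos by (intro power_mono) auto
  then have psi: "min 1 (m\<^sup>2) \<le> (\<psi> t)\<^sup>2" by linarith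
  \<comment> \<open>Equivalent to \<open>0 \<le> (2 * z + x)\<^sup>2\<close>.\<close>
  have sq: "x\<^sup>2 / 2 - z\<^sup>2 \<le> (z + x)\<^sup>2" for x z :: real
    using sum_squares_ge_zero[of 0 "2 * z + x"] by (simp add: power2_eq_square algebra_simps)
  have "min 1 (m\<^sup>2) / 2 * l\<^sup>2 = l\<^sup>2 * (min 1 (m\<^sup>2) / 2) * C + l\<^sup>2 * (min 1 (m\<^sup>2) / 2) * S"
    using SC(3) by (simp add: add.commute flip: distrib_left)
  also have "\<dots> \<le> l\<^sup>2 * ((\<psi> t)\<^sup>2 / 2) * C + l\<^sup>2 * (1 / 2) * S"
    using psi SC by (intro add_mono mult_right_mono mult_left_mono) auto
  also have "\<dots> \<le> (l * \<psi> t * cos (\<phi> t))\<^sup>2 / 2 - (y * sin (\<phi> t))\<^sup>2 + l\<^sup>2 * S"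
    using mult_right_mono[OF y SC(1)] by (simp add: S_def C_def power_mult_distrib algebra_simps)
  also have "\<dots> \<le> (y * sin (\<phi> t) + l * \<psi> t * cos (\<phi> t))\<^sup>2 + l\<^sup>2 * S"
    using sq by (intro add_right_mono)
  finally have *: "min 1 (m\<^sup>2) / 2 * l\<^sup>2 \<le> (y * sin (\<phi> t) + l * \<psi> t * cos (\<phi> t))\<^sup>2 + l\<^sup>2 * S" .
  have ampl2: "(ampl t)\<^sup>2 * exp (2 * b * t) = exp (2 * K * J t) / (\<psi> t * \<psi> 0 * l\<^sup>2)"
  proof -
    have "(exp (- b * t + K * J t - (ln (\<psi> t) + ln (\<psi> 0)) / 2))\<^sup>2 * exp (2 * b * t)
        = exp (2 * K * J t - (ln (\<psi> t) + ln (\<psi> 0)))"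
      by (simp add: power2_eq_square flip: exp_add)
    also have "\<dots> = exp (2 * K * J t) / (\<psi> t * \<psi> 0)"
      using psi_pos by (simp add: exp_diff exp_add)
    finally show ?thesis by (simp add: ampl_def power_divide)
  qed
  have "min 1 (m\<^sup>2) / (2 * s\<^sup>2) * exp (2 * K * J t) \<le> min 1 (m\<^sup>2) / (2 * (\<psi> t * \<psi> 0)) * exp (2 * K * J t)"
  proof -
    have "\<psi> t * \<psi> 0 \<le> s\<^sup>2"
      unfolding power2_eq_square using psi_pos psi_upper s_pos by (intro mult_mono) (auto intro: less_imp_le)
    then show ?thesis using psi_pos pos s_pos
      by (intro mult_right_mono divide_left_mono) (auto intro!: mult_pos_pos)
  qed
  also have "\<dots> = min 1 (m\<^sup>2) / 2 * l\<^sup>2 * ((ampl t)\<^sup>2 * exp (2 * b * t))"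
    unfolding ampl2 using pos by (simp add: field_simps)
  also have "\<dots> \<le> ((y * sin (\<phi> t) + l * \<psi> t * cos (\<phi> t))\<^sup>2 + l\<^sup>2 * S) * ((ampl t)\<^sup>2 * exp (2 * b * t))"
    by (intro mult_right_mono *) auto
  also have "\<dots> = ((sol' t)\<^sup>2 + l\<^sup>2 * (sol t)\<^sup>2) * exp (2 * b * t)"
  proof -
    have "sol' t = ampl t * (y * sin (\<phi> t) + l * \<psi> t * cos (\<phi> t))" by (simp add: sol'_def y_def)
    then show ?thesis
      by (simp only: sol_def S_def power_mult_distrib distrib_right) (simp add: mult_ac)
  qed
  finally show ?thesis .
qed

text \<open>The mean of sin\<phi> squared over a period is 1/2. The correction sin (2\<phi>) / (4 l
  \<psi>) in \<open>F\<close> removes the oscillating part of the integrand up to a term of order 1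
  / l caused by the variation of \<psi>.\<close>

lemma J_lower:
  assumes "0 \<le> t" "t \<le> T"
  shows "t / 2 - (1 + 2 * M * T) / (4 * m) / l \<le> J t"
proof -
  define F where "F = (\<lambda>t. J t - t / 2 + sin (2 * \<phi> t) / (4 * l * \<psi> t))"
  have F: "(F has_real_derivative - (q t * sin (2 * \<phi> t) / (2 * l * \<psi> t))) (at t)" for t
  proof -
    note J_deriv[derivative_intros] phi_deriv[derivative_intros] psi_deriv[derivative_intros]
    have c: "cos (2 * \<phi> t) = 1 - 2 * (sin (\<phi> t))\<^sup>2" by (simp add: cos_double_sin)
    show ?thesis
      unfolding F_def using pos psi_pos[of t]
      by (auto intro!: derivative_eq_intros simp: c) (simp add: field_simps power2_eq_square)
  qed
  have bd: "\<bar>- (q x * sin (2 * \<phi> x) / (2 * l * \<psi> x))\<bar> \<le> M / (2 * l * m)" for x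
  proof -
    have "\<bar>q x * sin (2 * \<phi> x)\<bar> \<le> M * 1"
      unfolding abs_mult using q_bound M_nonneg by (intro mult_mono) auto
    then show ?thesis
      using pos psi_pos[of x] psi_lower[of x] M_nonneg
      by (simp add: abs_mult) (intro frac_le, auto)
  qed
  have "\<bar>F t - F 0\<bar> \<le> M / (2 * l * m) * \<bar>t - 0\<bar>"
    using field_differentiable_bound[of UNIV F "\<lambda>t. - (q t * sin (2 * \<phi> t) / (2 * l * \<psi> t))" "M / (2 * l * m)" t 0]
      F bd by simp
  then have "\<bar>F t\<bar> \<le> M / (2 * l * m) * t" using assms by (simp add: F_def J_0 phi_0)
  also have "\<dots> \<le> M / (2 * l * m) * T" using assms M_nonneg pos by (intro mult_left_mono) auto
  finally have "\<bar>F t\<bar> \<le> M / (2 * l * m) * T" .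
  moreover have "\<bar>sin (2 * \<phi> t) / (4 * l * \<psi> t)\<bar> \<le> 1 / (4 * l * m)"
    using pos psi_pos[of t] psi_lower[of t]
    by (simp add: abs_mult) (intro frac_le, auto)
  ultimately have "t / 2 - M / (2 * l * m) * T - 1 / (4 * l * m) \<le> J t"
    unfolding F_def by linarith
  moreover have "M / (2 * l * m) * T + 1 / (4 * l * m) = (1 + 2 * M * T) / (4 * m) / l"
    using pos by (simp add: field_simps)
  ultimately show ?thesis by linarith
qed

lemma detuning_bound: "\<bar>K * (sin (\<phi> t))\<^sup>2 - q t\<bar> \<le> K + M"
proof -
  have "0 \<le> K * (sin (\<phi> t))\<^sup>2" "K * (sin (\<phi> t))\<^sup>2 \<le> K"
    using pos by (auto intro!: mult_left_le simp: abs_square_le_1)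
  then show ?thesis using q_bound[of t] by linarith
qed

text \<open>The quotient K / l is kept as a block: with K = k \<open>l powr (1 - \<alpha>)\<close>
  it becomes k \<open>l powr (- \<alpha>)\<close>, and the other term is of lower order.\<close>

lemma perturbation_bound: "\<bar>perturbation t\<bar> \<le> 2 * (K / l) * s + (M + (K + M)\<^sup>2) / l\<^sup>2"
proof -
  have "\<bar>\<psi> t * sin (2 * \<phi> t)\<bar> \<le> s * 1"
    unfolding abs_mult using psi_pos[of t] psi_upper[of t] by (intro mult_mono) auto
  then have "\<bar>- 2 * K / l * (\<psi> t * sin (2 * \<phi> t))\<bar> \<le> 2 * K / l * s"
    using pos by (simp add: abs_mult mult_left_mono divide_right_mono)
  moreover have "\<bar>K * (sin (\<phi> t))\<^sup>2 - q t\<bar>\<^sup>2 \<le> (K + M)\<^sup>2"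
    by (intro power_mono detuning_bound) auto
  then have "\<bar>q1 t - (K * (sin (\<phi> t))\<^sup>2 - q t)\<^sup>2\<bar> \<le> M + (K + M)\<^sup>2"
    using q1_bound[of t] zero_le_power2[of "K * (sin (\<phi> t))\<^sup>2 - q t"] unfolding power2_abs by linarith
  then have "\<bar>(q1 t - (K * (sin (\<phi> t))\<^sup>2 - q t)\<^sup>2) / l\<^sup>2\<bar> \<le> (M + (K + M)\<^sup>2) / l\<^sup>2"
    by (simp add: divide_right_mono)
  ultimately show ?thesis unfolding perturbation_def by linarith
qed

text \<open>Differentiating the fast oscillation costs a factor \<open>l\<close>, so the leading
  term is \<open>4 * K * s\<^sup>2\<close>; with the same choice of \<open>K\<close> everything else
  is of lower order.\<close>

lemma perturbation_lipschitz:
  "\<bar>perturbation t - perturbation u\<bar> \<le>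
    (2 * (K / l) * (2 * M * s + 2 * l * s\<^sup>2) + (M + 2 * (K + M) * (K * l * s + M)) / l\<^sup>2) * \<bar>t - u\<bar>"
proof -
  define D where "D = (\<lambda>t. - 2 * K / l * (2 * q t * \<psi> t * sin (2 * \<phi> t) + 2 * l * (\<psi> t)\<^sup>2 * cos (2 * \<phi> t))
    + (q2 t - 2 * (K * (sin (\<phi> t))\<^sup>2 - q t) * (K * l * \<psi> t * sin (2 * \<phi> t) - q1 t)) / l\<^sup>2)"
  have "(perturbation has_real_derivative D t) (at t)" for t
  proof -
    note phi_deriv[derivative_intros] psi_deriv[derivative_intros]
      q_deriv[derivative_intros] q1_deriv[derivative_intros]
    have "((\<lambda>t. \<psi> t * sin (2 * \<phi> t)) has_real_derivative
        2 * q t * \<psi> t * sin (2 * \<phi> t) + 2 * l * (\<psi> t)\<^sup>2 * cos (2 * \<phi> t)) (at t)"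
      by (auto intro!: derivative_eq_intros simp: power2_eq_square)
    moreover have "((\<lambda>t. q1 t - (K * (sin (\<phi> t))\<^sup>2 - q t)\<^sup>2) has_real_derivative
        q2 t - 2 * (K * (sin (\<phi> t))\<^sup>2 - q t) * (K * l * \<psi> t * sin (2 * \<phi> t) - q1 t)) (at t)"
      unfolding sin_double by (rule derivative_eq_intros refl | simp)+ (simp add: algebra_simps)
    ultimately show ?thesis
      unfolding perturbation_def D_def by (intro DERIV_add DERIV_cmult DERIV_cdivide)
  qed
  moreover have "\<bar>D t\<bar> \<le> 2 * (K / l) * (2 * M * s + 2 * l * s\<^sup>2) + (M + 2 * (K + M) * (K * l * s + M)) / l\<^sup>2" for t
  proof -
    have a: "\<bar>\<psi> t\<bar> \<le> s" using psi_pos[of t] psi_upper[of t] by auto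
    have "\<bar>2 * q t * \<psi> t * sin (2 * \<phi> t)\<bar> \<le> 2 * M * s * 1"
      unfolding abs_mult using a q_bound M_nonneg s_pos by (intro mult_mono) auto
    moreover have "\<bar>2 * l * (\<psi> t)\<^sup>2 * cos (2 * \<phi> t)\<bar> \<le> 2 * l * s\<^sup>2 * 1"
      unfolding abs_mult power_abs using a pos by (intro mult_mono power_mono) auto
    ultimately have "\<bar>2 * q t * \<psi> t * sin (2 * \<phi> t) + 2 * l * (\<psi> t)\<^sup>2 * cos (2 * \<phi> t)\<bar> \<le> 2 * M * s + 2 * l * s\<^sup>2"
      by linarith
    then have 1: "\<bar>- 2 * K / l * (2 * q t * \<psi> t * sin (2 * \<phi> t) + 2 * l * (\<psi> t)\<^sup>2 * cos (2 * \<phi> t))\<bar>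
        \<le> 2 * (K / l) * (2 * M * s + 2 * l * s\<^sup>2)"
      unfolding abs_mult[of "- 2 * K / l"] using pos by (intro mult_mono) auto
    have "\<bar>K * l * \<psi> t * sin (2 * \<phi> t)\<bar> \<le> K * l * s * 1"
      unfolding abs_mult using a pos s_pos by (intro mult_mono) auto
    then have "\<bar>K * l * \<psi> t * sin (2 * \<phi> t) - q1 t\<bar> \<le> K * l * s + M"
      using q1_bound[of t] by linarith
    then have "\<bar>2 * (K * (sin (\<phi> t))\<^sup>2 - q t) * (K * l * \<psi> t * sin (2 * \<phi> t) - q1 t)\<bar>
        \<le> 2 * (K + M) * (K * l * s + M)"
      unfolding abs_mult using detuning_bound[of t] pos M_nonneg by (intro mult_mono) auto
    then have "\<bar>q2 t - 2 * (K * (sin (\<phi> t))\<^sup>2 - q t) * (K * l * \<psi> t * sin (2 * \<phi> t) - q1 t)\<bar>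
        \<le> M + 2 * (K + M) * (K * l * s + M)"
      using q2_bound[of t] by linarith
    then have 2: "\<bar>(q2 t - 2 * (K * (sin (\<phi> t))\<^sup>2 - q t) * (K * l * \<psi> t * sin (2 * \<phi> t) - q1 t)) / l\<^sup>2\<bar>
        \<le> (M + 2 * (K + M) * (K * l * s + M)) / l\<^sup>2"
      by (simp add: divide_right_mono)
    show ?thesis unfolding D_def using 1 2 by linarith
  qed
  ultimately show ?thesis
    using field_differentiable_bound[of UNIV perturbation D _ t u] by simp
qed

end

subsection \<open>Stability under perturbation of the coefficient\<close>

text \<open>A Gronwall estimate for the squared difference \<open>e\<close>, which vanishes at 0.
  Writing d v - c w as d (v - w) - (c - d) w puts the forcing on \<open>w\<close> alone, so no bound
  on the nearby solution \<open>v\<close> is required.\<close>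

lemma solution_difference_bound:
  assumes sol: "is_solution \<delta> \<sigma> c l w w'" "is_solution \<delta> \<sigma> d l v v'"
    and "0 \<le> \<delta>" "0 \<le> \<epsilon>" "0 \<le> C"
    and d: "\<And>t. 0 \<le> t \<Longrightarrow> \<bar>d t\<bar> \<le> C" and cd: "\<And>t. 0 \<le> t \<Longrightarrow> \<bar>c t - d t\<bar> \<le> \<epsilon>"
    and W: "\<And>t. 0 \<le> t \<Longrightarrow> t \<le> T \<Longrightarrow> \<bar>w t\<bar> \<le> W"
    and t: "0 \<le> t" "t \<le> T"
  shows "(v' t - w' t)\<^sup>2 + (v t - w t)\<^sup>2 \<le> (l\<^sup>2 * \<epsilon> * W)\<^sup>2 * exp ((l\<^sup>2 * C + 2) * t)"
proof -
  define b where "b = \<delta> * l powr (2 * \<sigma>)"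
  have b: "0 \<le> b" using assms(3) by (simp add: b_def)
  have dw: "(w has_real_derivative w' x) (at x within {0..})"
    "(w' has_real_derivative - 2 * b * w' x - l\<^sup>2 * c x * w x) (at x within {0..})"
    "(v has_real_derivative v' x) (at x within {0..})"
    "(v' has_real_derivative - 2 * b * v' x - l\<^sup>2 * d x * v x) (at x within {0..})" if "0 \<le> x" for x
    using sol that unfolding is_solution_def b_def mult.assoc by auto
  define A where "A = l\<^sup>2 * C + 2"
  define D where "D = (l\<^sup>2 * \<epsilon> * W)\<^sup>2"
  define e where "e = (\<lambda>x. (v' x - w' x)\<^sup>2 + (v x - w x)\<^sup>2)"
  define e' where "e' = (\<lambda>x. 2 * (v' x - w' x) * ((- 2 * b * v' x - l\<^sup>2 * d x * v x) - (- 2 * b * w' x - l\<^sup>2 * c x * w x))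
      + 2 * (v x - w x) * (v' x - w' x))"
  \<comment> \<open>The shift by \<open>D\<close> absorbs the forcing term, so that \<open>g\<close>
    is nonincreasing.\<close>
  define g where "g = (\<lambda>x. (e x + D) * exp (- A * x))"
  have A: "2 \<le> A" using assms(5) by (simp add: A_def)
  have D: "0 \<le> D" by (simp add: D_def)
  have e_deriv: "(e has_real_derivative e' x) (at x within {0..})" if "0 \<le> x" for x
    unfolding e_def e'_def
    by (rule derivative_eq_intros dw that refl | simp)+ (simp add: algebra_simps)
  have g_deriv: "(g has_real_derivative (e' x - A * (e x + D)) * exp (- A * x)) (at x within {0..})" if "0 \<le> x" for x
    unfolding g_def
    by (rule derivative_eq_intros e_deriv that refl | simp)+ (simp add: algebra_simps)
  have e'_le: "e' x \<le> A * (e x + D)" if x: "0 \<le> x" "x \<le> T" for x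
  proof -
    define y z where "y = v' x - w' x" and "z = v x - w x"
    \<comment> \<open>The damping enters with a favourable sign; the remaining three products are
      bounded by sums of squares.\<close>
    have "e' x = - 4 * (b * y\<^sup>2) + - 2 * y * (l\<^sup>2 * d x * z) + 2 * y * (l\<^sup>2 * (c x - d x) * w x) + 2 * z * y"
      unfolding e'_def y_def z_def by (simp add: algebra_simps power2_eq_square)
    moreover have "0 \<le> b * y\<^sup>2" using b by simp
    moreover have "- 2 * y * (l\<^sup>2 * d x * z) \<le> l\<^sup>2 * C * (y\<^sup>2 + z\<^sup>2)"
    proof -
      have "- 2 * y * (l\<^sup>2 * d x * z) \<le> \<bar>l\<^sup>2 * d x\<bar> * \<bar>2 * y * z\<bar>"
        using abs_ge_minus_self[of "l\<^sup>2 * d x * (2 * y * z)"] unfolding abs_mult[of "l\<^sup>2 * d x"]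
        by (simp add: mult.assoc mult.left_commute)
      also have "\<dots> \<le> (l\<^sup>2 * C) * (y\<^sup>2 + z\<^sup>2)"
      proof (rule mult_mono)
        show "\<bar>l\<^sup>2 * d x\<bar> \<le> l\<^sup>2 * C" using d[OF x(1)] by (simp add: abs_mult mult_left_mono)
        show "\<bar>2 * y * z\<bar> \<le> y\<^sup>2 + z\<^sup>2"
          using sum_squares_bound[of y z] sum_squares_bound[of "- y" z] by (simp add: abs_le_iff)
      qed (use assms(5) in auto)
      finally show ?thesis .
    qed
    moreover have "2 * y * (l\<^sup>2 * (c x - d x) * w x) \<le> y\<^sup>2 + D"
    proof -
      have "\<bar>l\<^sup>2 * (c x - d x) * w x\<bar> \<le> l\<^sup>2 * \<epsilon> * W"
        unfolding abs_mult using cd[OF x(1)] W[OF x] assms(4) by (intro mult_mono) auto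
      then have "(l\<^sup>2 * (c x - d x) * w x)\<^sup>2 \<le> D"
        unfolding D_def by (metis abs_ge_zero power2_abs power_mono)
      then show ?thesis using sum_squares_bound[of y "l\<^sup>2 * (c x - d x) * w x"] by linarith
    qed
    moreover have "2 * z * y \<le> y\<^sup>2 + z\<^sup>2" using sum_squares_bound[of z y] by simp
    moreover have "2 * D \<le> A * D" using A D by (intro mult_right_mono)
    moreover have "A * (e x + D) = l\<^sup>2 * C * (y\<^sup>2 + z\<^sup>2) + 2 * y\<^sup>2 + 2 * z\<^sup>2 + A * D"
      unfolding A_def e_def y_def[symmetric] z_def[symmetric] by (simp add: algebra_simps)
    ultimately show ?thesis using D zero_le_power2[of z] by linarith
  qed
  have "g t \<le> g 0"
  proof (rule DERIV_nonpos_imp_decreasing_open[OF t(1)])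
    fix x assume x: "0 < x" "x < t"
    have "at x within {0..} = at x" using x by (intro at_within_interior) (simp add: interior_Ici)
    then have "(g has_real_derivative (e' x - A * (e x + D)) * exp (- A * x)) (at x)"
      using g_deriv[of x] x by simp
    moreover have "(e' x - A * (e x + D)) * exp (- A * x) \<le> 0"
      using e'_le[of x] x t by (intro mult_nonpos_nonneg) auto
    ultimately show "\<exists>y. (g has_real_derivative y) (at x) \<and> y \<le> 0" by blast
  next
    have "continuous_on {0..} g"
      unfolding continuous_on_eq_continuous_within using g_deriv DERIV_continuous by blast
    then show "continuous_on {0..t} g" by (rule continuous_on_subset) auto
  qed
  moreover have "g 0 = D" using sol by (simp add: g_def e_def is_solution_def)
  ultimately have "(e t + D) * exp (- A * t) \<le> D" by (simp add: g_def)
  then have "e t + D \<le> D * exp (A * t)" by (simp add: exp_minus field_simps)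
  then show ?thesis using D unfolding e_def D_def A_def by linarith
qed

text \<open>The tolerance depends on the fixed solution \<open>w\<close> and on \<open>C\<close>,
  \<open>T\<close>, \<open>\<eta>\<close>, \<open>l\<close>, but not on \<open>d\<close> or
  \<open>v\<close>: this uniformity gives a whole neighbourhood of \<open>c\<close>. The factor 2
  comes from splitting each square.\<close>

lemma energy_stability:
  assumes sol: "is_solution \<delta> \<sigma> c l w w'" and "0 \<le> \<delta>" "0 \<le> C" "0 < \<eta>"
  obtains \<epsilon> where "0 < \<epsilon>"
    "\<And>d v v' t. is_solution \<delta> \<sigma> d l v v' \<Longrightarrow> (\<And>t. 0 \<le> t \<Longrightarrow> \<bar>d t\<bar> \<le> C) \<Longrightarrow>
      (\<And>t. 0 \<le> t \<Longrightarrow> \<bar>c t - d t\<bar> \<le> \<epsilon>) \<Longrightarrow> 0 \<le> t \<Longrightarrow> t \<le> T \<Longrightarrow>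
      (w' t)\<^sup>2 + l\<^sup>2 * (w t)\<^sup>2 \<le> 2 * ((v' t)\<^sup>2 + l\<^sup>2 * (v t)\<^sup>2) + \<eta>"
proof -
  have "(w has_real_derivative w' x) (at x within {0..})" if "0 \<le> x" for x
    using sol that by (simp add: is_solution_def)
  then have "continuous_on {0..} w"
    unfolding continuous_on_eq_continuous_within using DERIV_continuous by blast
  then have "continuous_on {0..T} w" by (rule continuous_on_subset) auto
  then have "bounded (w ` {0..T})" by (intro compact_imp_bounded compact_continuous_image) auto
  then obtain W where W: "\<And>t. 0 \<le> t \<Longrightarrow> t \<le> T \<Longrightarrow> \<bar>w t\<bar> \<le> W"
    unfolding bounded_iff by (metis atLeastAtMost_iff image_eqI real_norm_def)
  define A where "A = l\<^sup>2 * C + 2"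
  \<comment> \<open>The Gronwall bound is quadratic in the tolerance, hence the choice sqrt (\<eta>
    / G) below; the summand 1 makes \<open>G\<close> positive.\<close>
  define G where "G = 2 * (1 + l\<^sup>2) * (l\<^sup>2 * W)\<^sup>2 * exp (A * T) + 1"
  have G: "0 < G" unfolding G_def by (intro add_nonneg_pos) auto
  have A: "0 \<le> A" using assms(3) by (simp add: A_def)
  show ?thesis
  proof
    show "0 < sqrt (\<eta> / G)" using G assms(4) by simp
    fix d v v' t
    assume v: "is_solution \<delta> \<sigma> d l v v'" and d: "\<And>t. 0 \<le> t \<Longrightarrow> \<bar>d t\<bar> \<le> C"
      and cd: "\<And>t. 0 \<le> t \<Longrightarrow> \<bar>c t - d t\<bar> \<le> sqrt (\<eta> / G)" and t: "0 \<le> t" "t \<le> T"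
    define y z where "y = v' t - w' t" and "z = v t - w t"
    have "y\<^sup>2 + z\<^sup>2 \<le> (l\<^sup>2 * sqrt (\<eta> / G) * W)\<^sup>2 * exp (A * t)"
      unfolding y_def z_def A_def
      by (rule solution_difference_bound[OF sol v _ _ _ d cd W t]) (use assms G in auto)
    also have "\<dots> \<le> (l\<^sup>2 * sqrt (\<eta> / G) * W)\<^sup>2 * exp (A * T)"
      using A t by (intro mult_left_mono) (auto intro: mult_left_mono)
    also have "\<dots> = \<eta> / G * ((l\<^sup>2 * W)\<^sup>2 * exp (A * T))"
      using G assms(4) by (simp add: power_mult_distrib)
    finally have yz: "y\<^sup>2 + z\<^sup>2 \<le> \<eta> / G * ((l\<^sup>2 * W)\<^sup>2 * exp (A * T))" .
    have "2 * (y\<^sup>2 + l\<^sup>2 * z\<^sup>2) \<le> 2 * (1 + l\<^sup>2) * (y\<^sup>2 + z\<^sup>2)"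
      by (simp add: algebra_simps)
    also have "\<dots> \<le> 2 * (1 + l\<^sup>2) * (\<eta> / G * ((l\<^sup>2 * W)\<^sup>2 * exp (A * T)))"
      by (intro mult_left_mono yz) auto
    also have "\<dots> = \<eta> / G * (G - 1)" by (simp add: G_def)
    also have "\<dots> \<le> \<eta>" using G assms(4) by (simp add: field_simps)
    finally have yz': "2 * (y\<^sup>2 + l\<^sup>2 * z\<^sup>2) \<le> \<eta>" .
    have sq: "a\<^sup>2 \<le> 2 * x\<^sup>2 + 2 * (x - a)\<^sup>2" for a x :: real
      using zero_le_power2[of "2 * x - a"] by (simp add: power2_eq_square algebra_simps)
    have "(w' t)\<^sup>2 \<le> 2 * (v' t)\<^sup>2 + 2 * y\<^sup>2" unfolding y_def by (rule sq)
    moreover have "l\<^sup>2 * (w t)\<^sup>2 \<le> l\<^sup>2 * (2 * (v t)\<^sup>2 + 2 * z\<^sup>2)"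
      unfolding z_def by (intro mult_left_mono sq) auto
    ultimately show "(w' t)\<^sup>2 + l\<^sup>2 * (w t)\<^sup>2 \<le> 2 * ((v' t)\<^sup>2 + l\<^sup>2 * (v t)\<^sup>2) + \<eta>"
      using yz' by (simp add: algebra_simps)
  qed
qed

section \<open>The uniform distance and relative interiors\<close>

lemma udist_le:
  assumes "\<And>t. 0 \<le> t \<Longrightarrow> \<bar>c t - d t\<bar> \<le> r"
  shows "udist c d \<le> r"
  unfolding udist_def by (rule cSUP_least) (use assms in auto)

text \<open>Members of \<open>PS\<close> take values in [\<mu>1, \<mu>2], so the real supremum is
  over a bounded set.\<close>

lemma le_udist:
  assumes "c \<in> PS \<mu>1 \<mu>2 \<alpha> H" "d \<in> PS \<mu>1 \<mu>2 \<alpha> H" "0 \<le> t"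
  shows "\<bar>c t - d t\<bar> \<le> udist c d"
  unfolding udist_def
proof (rule cSUP_upper)
  have "\<bar>c x - d x\<bar> \<le> \<mu>2 - \<mu>1" if "0 \<le> x" for x
  proof -
    have "\<mu>1 \<le> c x" "c x \<le> \<mu>2" "\<mu>1 \<le> d x" "d x \<le> \<mu>2"
      using assms(1,2) that by (auto simp: PS_def)
    then show ?thesis by linarith
  qed
  then show "bdd_above ((\<lambda>t. \<bar>c t - d t\<bar>) ` {0..})" by (auto intro!: bdd_aboveI)
qed (use assms in auto)

lemma udist_triangle:
  assumes "c \<in> PS \<mu>1 \<mu>2 \<alpha> H" "d \<in> PS \<mu>1 \<mu>2 \<alpha> H" "f \<in> PS \<mu>1 \<mu>2 \<alpha> H"
  shows "udist c f \<le> udist c d + udist d f"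
proof (rule udist_le)
  fix t :: real assume "0 \<le> t"
  then show "\<bar>c t - f t\<bar> \<le> udist c d + udist d f"
    using le_udist[OF assms(1,2), of t] le_udist[OF assms(2,3), of t] by linarith
qed

text \<open>The triangle inequality with two halves of the radius shows that the interior of any
  \<open>G\<close> relative to the space is open.\<close>

lemma open_interior_in_PS:
  fixes \<mu>1 \<mu>2 \<alpha> H :: real
  defines "X \<equiv> PS \<mu>1 \<mu>2 \<alpha> H"
  shows "open_in_space X {c \<in> X. \<exists>\<epsilon>>0. \<forall>d\<in>X. udist c d < \<epsilon> \<longrightarrow> d \<in> G}"
  unfolding open_in_space_def
proof (intro conjI ballI)
  fix c assume "c \<in> {c \<in> X. \<exists>\<epsilon>>0. \<forall>d\<in>X. udist c d < \<epsilon> \<longrightarrow> d \<in> G}"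
  then obtain \<epsilon> where c: "c \<in> X" and \<epsilon>: "0 < \<epsilon>" "\<And>d. d \<in> X \<Longrightarrow> udist c d < \<epsilon> \<Longrightarrow> d \<in> G" by auto
  have "f \<in> G" if "d \<in> X" "udist c d < \<epsilon> / 2" "f \<in> X" "udist d f < \<epsilon> / 2" for d f
    using udist_triangle[of c \<mu>1 \<mu>2 \<alpha> H d f] that c \<epsilon>(2)[of f] by (simp add: X_def)
  then have "\<forall>d\<in>X. udist c d < \<epsilon> / 2 \<longrightarrow> (\<forall>f\<in>X. udist d f < \<epsilon> / 2 \<longrightarrow> f \<in> G)" by blast
  moreover have "0 < \<epsilon> / 2" using \<epsilon>(1) by simp
  ultimately show "\<exists>\<epsilon>>0. \<forall>d\<in>X. udist c d < \<epsilon> \<longrightarrow> d \<in> {c \<in> X. \<exists>\<epsilon>>0. \<forall>d\<in>X. udist c d < \<epsilon> \<longrightarrow> d \<in> G}"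
    by blast
qed auto

subsection \<open>Density and residuality\<close>

lemma sublinear_power_eventually:
  fixes \<delta> \<beta> r :: real
  assumes "0 \<le> \<delta>" "\<beta> < 1" "0 < r"
  shows "\<forall>\<^sub>F x in at_top. \<delta> * x powr \<beta> \<le> r * x"
proof (cases "\<delta> = 0")
  case True
  show ?thesis unfolding True using eventually_ge_at_top[of 0] by eventually_elim (use assms in simp)
next
  case False
  then have "0 < \<delta>" using assms by simp
  then show ?thesis using assms by real_asymp
qed

lemma le_Limsup_frequently:
  fixes f :: "'a \<Rightarrow> 'b :: complete_lattice"
  assumes "\<exists>\<^sub>F x in F. C \<le> f x"
  shows "C \<le> Limsup F f"
  unfolding Limsup_def
proof (rule INF_greatest)
  fix P assume "P \<in> {P. eventually P F}"
  then obtain x where "P x" "C \<le> f x"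
    using frequently_eventually_frequently[OF assms] frequently_ex by fastforce
  then show "C \<le> Sup (f ` Collect P)" by (meson SUP_upper2 mem_Collect_eq)
qed

text \<open>A smooth profile near \<open>c0\<close> is perturbed at a single large frequency
  \<open>lam i\<close>. Since the growth rate k exceeds \<mu>5, the normalised energy passes any
  level \<open>Z\<close> on [\<tau>, T], which must stay away from 0, where it is 1.\<close>

lemma activators_dense:
  fixes \<mu>1 \<mu>2 \<alpha> H \<delta> \<sigma> \<mu>5 \<epsilon> \<tau> T Z :: real and lam :: "nat \<Rightarrow> real"
  assumes \<mu>: "0 < \<mu>1" "\<mu>1 < \<mu>2" and \<alpha>: "0 < \<alpha>" "\<alpha> < 1" and H: "0 < H" and \<delta>: "0 \<le> \<delta>" and \<sigma>: "\<sigma> < 1/2"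
    and lam: "\<forall>i. lam i > 0" "filterlim lam at_top sequentially"
    and c0: "c0 \<in> PS \<mu>1 \<mu>2 \<alpha> H" and \<epsilon>: "0 < \<epsilon>" and \<tau>: "0 < \<tau>" "\<tau> \<le> T" and Z: "0 < Z"
    and \<mu>5: "\<mu>5 = H / (16 * \<mu>2 powr ((1 + \<alpha>) / 2))"
  obtains i c w w' where "n \<le> i" "c \<in> PS \<mu>1 \<mu>2 \<alpha> H" "udist c0 c < \<epsilon>"
    "is_solution \<delta> \<sigma> c (lam i) w w'"
    "\<And>t. \<tau> \<le> t \<Longrightarrow> t \<le> T \<Longrightarrow> Z \<le> ((w' t)\<^sup>2 + (lam i)\<^sup>2 * (w t)\<^sup>2) *
       exp (- \<mu>5 * lam i powr (1 - \<alpha>) * t + 2 * \<delta> * lam i powr (2 * \<sigma>) * t)"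
proof (rule smooth_profile[OF \<mu> \<alpha>(1) H _ c0, of "\<epsilon> / 2"])
  show "0 < \<epsilon> / 2" using \<epsilon> by simp
next
  fix \<psi> q q1 q2 :: "real \<Rightarrow> real" and M \<theta> \<kappa> :: real
  assume psi_deriv: "\<And>t. (\<psi> has_real_derivative 2 * q t * \<psi> t) (at t)"
    and q_deriv: "\<And>t. (q has_real_derivative q1 t) (at t)" "\<And>t. (q1 has_real_derivative q2 t) (at t)"
    and const_bounds: "0 < \<kappa>" "\<theta> < 1" "0 < M"
    and psi_range: "\<And>t. sqrt \<mu>1 \<le> \<psi> t" "\<And>t. \<psi> t \<le> sqrt \<mu>2"
    and psi2_range: "\<And>t. \<mu>1 + \<kappa> \<le> (\<psi> t)\<^sup>2" "\<And>t. (\<psi> t)\<^sup>2 \<le> \<mu>2 - \<kappa>"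
    and q_bound: "\<And>t. \<bar>q t\<bar> \<le> M" "\<And>t. \<bar>q1 t\<bar> \<le> M" "\<And>t. \<bar>q2 t\<bar> \<le> M"
    and psi2_holder: "\<And>t s. \<bar>(\<psi> t)\<^sup>2 - (\<psi> s)\<^sup>2\<bar> \<le> \<theta> * H * \<bar>t - s\<bar> powr \<alpha>"
    and psi2_close: "\<And>t. 0 \<le> t \<Longrightarrow> \<bar>c0 t - (\<psi> t)\<^sup>2\<bar> < \<epsilon> / 2"
  define s m k L where "s = sqrt \<mu>2" and "m = sqrt \<mu>1" and "k = 3 / 2 * \<mu>5" and "L = 4 * M * \<mu>2"
  have cpos: "0 < s" "0 < m" "0 < k" "0 < L" "0 < \<mu>5" using \<mu> H const_bounds
    by (auto simp: s_def m_def k_def L_def \<mu>5)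
  have psi2_lip: "\<bar>(\<psi> t)\<^sup>2 - (\<psi> u)\<^sup>2\<bar> \<le> L * \<bar>t - u\<bar>" for t u
  proof -
    have "((\<lambda>t. (\<psi> t)\<^sup>2) has_real_derivative 4 * q t * (\<psi> t)\<^sup>2) (at t)" for t
      by (auto intro!: derivative_eq_intros psi_deriv simp: power2_eq_square)
    moreover have "\<bar>4 * q t * (\<psi> t)\<^sup>2\<bar> \<le> L" for t
    proof -
      have "(\<psi> t)\<^sup>2 \<le> \<mu>2" using psi2_range[of t] const_bounds by linarith
      then show ?thesis unfolding L_def abs_mult using q_bound(1)[of t] const_bounds
        by (intro mult_mono) auto
    qed
    ultimately show ?thesis
      using field_differentiable_bound[of UNIV "\<lambda>t. (\<psi> t)\<^sup>2" "\<lambda>t. 4 * q t * (\<psi> t)\<^sup>2" L t u] by simp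
  qed
  \<comment> \<open>Solves \<open>L * \<eta> powr (1 - \<alpha>) = H / 4\<close>, the share of the
    smooth profile at short distances.\<close>
  define \<eta> where "\<eta> = (H / (4 * L)) powr (1 / (1 - \<alpha>))"
  have \<eta>: "0 < \<eta>" "L * \<eta> powr (1 - \<alpha>) \<le> H / 4"
    using cpos H \<alpha> by (auto simp: \<eta>_def powr_powr)
  \<comment> \<open>The three entries keep the perturbed coefficient in range, keep it close to
    \<open>c0\<close>, and control Hoelder increments at distances beyond \<eta>.\<close>
  define A0 where "A0 = min (\<kappa> / 2) (min (\<epsilon> / 4) ((1 - \<theta>) * H * \<eta> powr \<alpha> / 2))"
  have A0: "0 < A0" using const_bounds \<epsilon> H \<eta> by (auto simp: A0_def)
  \<comment> \<open>\<open>r\<close> bounds b / l. Its square uses the other half of \<kappa> and a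
    further \<epsilon>/8, for a total distance of at most 7\<epsilon>/8; the entry 1/4 serves the
    hypothesis of \<open>energy_lower\<close>.\<close>
  define r where "r = min (1 / 4) (min (\<kappa> / 2) (\<epsilon> / 8))"
  have r: "0 < r" "r \<le> 1 / 4" "r\<^sup>2 \<le> \<kappa> / 2" "r\<^sup>2 \<le> \<epsilon> / 8"
  proof -
    show r0: "0 < r" "r \<le> 1 / 4" using const_bounds \<epsilon> by (auto simp: r_def)
    then have "r\<^sup>2 \<le> r" by (simp add: power2_eq_square mult_left_le)
    then show "r\<^sup>2 \<le> \<kappa> / 2" "r\<^sup>2 \<le> \<epsilon> / 8" unfolding r_def by linarith+
  qed
  \<comment> \<open>\<open>D\<close> is the prefactor in \<open>energy_lower\<close>;
    \<open>C\<close> is 2 k times the error constant in \<open>J_lower\<close>.\<close>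
  define D C where "D = min 1 (m\<^sup>2) / (2 * s\<^sup>2)" and "C = 2 * k * ((1 + 2 * M * T) / (4 * m))"
  have DC: "0 < D" "0 < C" using cpos const_bounds \<tau> by (auto simp: D_def C_def intro!: mult_pos_pos divide_pos_pos add_pos_pos)
  \<comment> \<open>The first two conditions bound the sup and Lipschitz constants of the
    perturbation by twice their leading terms. The next three give smallness, weak damping and slow
    amplitude; the last makes the growth exceed \<open>Z\<close>.\<close>
  define good where "good = (\<lambda>x.
      2 * k * s * x powr (-\<alpha>) + (M + (k * x powr (1-\<alpha>) + M)\<^sup>2) / x\<^sup>2 \<le> 4 * k * s * x powr (-\<alpha>)
    \<and> 2 * k * x powr (-\<alpha>) * (2 * M * s + 2 * x * s\<^sup>2)
      + (M + 2 * (k * x powr (1-\<alpha>) + M) * (k * x powr (1-\<alpha>) * x * s + M)) / x\<^sup>2 \<le> 8 * k * s\<^sup>2 * x powr (1-\<alpha>)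
    \<and> 4 * k * s * x powr (-\<alpha>) \<le> A0
    \<and> \<delta> * x powr (2 * \<sigma>) \<le> r * x
    \<and> k * x powr (1-\<alpha>) + M \<le> x / 4
    \<and> Z \<le> D * exp (x powr (1-\<alpha>) * (\<mu>5 / 2 * \<tau> - C / x)))"
  have "\<forall>\<^sub>F x in at_top. 2 * k * s * x powr (-\<alpha>) + (M + (k * x powr (1-\<alpha>) + M)\<^sup>2) / x\<^sup>2 \<le> 4 * k * s * x powr (-\<alpha>)"
    using \<alpha> cpos const_bounds by real_asymp
  moreover have "\<forall>\<^sub>F x in at_top. 2 * k * x powr (-\<alpha>) * (2 * M * s + 2 * x * s\<^sup>2)
      + (M + 2 * (k * x powr (1-\<alpha>) + M) * (k * x powr (1-\<alpha>) * x * s + M)) / x\<^sup>2 \<le> 8 * k * s\<^sup>2 * x powr (1-\<alpha>)"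
    using \<alpha> cpos const_bounds by real_asymp
  moreover have "\<forall>\<^sub>F x in at_top. 4 * k * s * x powr (-\<alpha>) \<le> A0"
    using \<alpha> cpos A0 by real_asymp
  moreover have "\<forall>\<^sub>F x in at_top. \<delta> * x powr (2 * \<sigma>) \<le> r * x"
    using \<delta> \<sigma> r by (intro sublinear_power_eventually) auto
  moreover have "\<forall>\<^sub>F x in at_top. k * x powr (1-\<alpha>) + M \<le> x / 4"
    using \<alpha> cpos const_bounds by real_asymp
  moreover have "\<forall>\<^sub>F x in at_top. Z \<le> D * exp (x powr (1-\<alpha>) * (\<mu>5 / 2 * \<tau> - C / x))"
    using \<alpha> cpos DC \<tau> Z by real_asymp
  ultimately have "\<forall>\<^sub>F x in at_top. good x"
    unfolding good_def by (intro eventually_conj)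
  from eventually_compose_filterlim[OF this lam(2)] eventually_ge_at_top[of n]
  have "\<forall>\<^sub>F i in sequentially. n \<le> i \<and> good (lam i)"
    by eventually_elim blast
  then obtain i where i: "n \<le> i" "good (lam i)"
    using eventually_happens'[OF sequentially_bot] by blast
  define l where "l = lam i"
  define K b where "K = k * l powr (1 - \<alpha>)" and "b = \<delta> * l powr (2 * \<sigma>)"
  have good: "2 * k * s * l powr (-\<alpha>) + (M + (K + M)\<^sup>2) / l\<^sup>2 \<le> 4 * k * s * l powr (-\<alpha>)"
    "2 * k * l powr (-\<alpha>) * (2 * M * s + 2 * l * s\<^sup>2)
      + (M + 2 * (K + M) * (K * l * s + M)) / l\<^sup>2 \<le> 8 * k * s\<^sup>2 * l powr (1-\<alpha>)"
    "4 * k * s * l powr (-\<alpha>) \<le> A0" "b \<le> r * l" "K + M \<le> l / 4"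
    "Z \<le> D * exp (l powr (1-\<alpha>) * (\<mu>5 / 2 * \<tau> - C / l))"
    using i(2) unfolding good_def l_def K_def b_def by - (elim conjE; assumption)+
  have l: "0 < l" using lam by (simp add: l_def)
  have "continuous_on UNIV (\<lambda>t. l * \<psi> t)"
    by (intro continuous_intros DERIV_continuous_on[where D = "\<lambda>t. 2 * q t * \<psi> t"])
      (use psi_deriv in \<open>auto intro: has_field_derivative_at_within\<close>)
  then obtain \<phi> where phi: "\<phi> 0 = 0" "\<And>t. (\<phi> has_real_derivative l * \<psi> t) (at t)"
    by (rule continuous_antiderivative) blast
  have "continuous_on UNIV (\<lambda>t. (sin (\<phi> t))\<^sup>2)"
    by (intro continuous_intros DERIV_continuous_on[where D = "\<lambda>t. l * \<psi> t"])
      (use phi in \<open>auto intro: has_field_derivative_at_within\<close>)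
  then obtain J where J: "J 0 = 0" "\<And>t. (J has_real_derivative (sin (\<phi> t))\<^sup>2) (at t)"
    by (rule continuous_antiderivative) blast
  interpret parametric_resonance \<psi> q q1 q2 \<phi> J l K b m s M
    by unfold_locales
      (use psi_deriv q_deriv phi J cpos l \<delta> psi_range q_bound in \<open>auto simp: K_def b_def s_def m_def\<close>)
  have Kb: "0 \<le> K" "0 \<le> b" using cpos \<delta> by (simp_all add: K_def b_def)
  have Kl: "K / l = k * l powr (-\<alpha>)"
    using l by (simp add: K_def powr_diff powr_minus field_simps)
  define A B where "A = 4 * k * s * l powr (-\<alpha>)" and "B = 8 * k * s\<^sup>2 * l powr (1-\<alpha>)"
  have AB: "0 \<le> A" "0 \<le> B" using cpos by (auto simp: A_def B_def)
  have P_sup: "\<bar>perturbation t\<bar> \<le> A" for t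
    using perturbation_bound[of t] good(1) unfolding Kl A_def by (simp add: mult_ac)
  have P_lip: "\<bar>perturbation t - perturbation u\<bar> \<le> B * \<bar>t - u\<bar>" for t u
  proof -
    have "2 * (K / l) * (2 * M * s + 2 * l * s\<^sup>2) + (M + 2 * (K + M) * (K * l * s + M)) / l\<^sup>2 \<le> B"
      using good(2) unfolding Kl B_def by (simp add: mult_ac)
    from mult_right_mono[OF this abs_ge_zero[of "t - u"]] show ?thesis
      using perturbation_lipschitz[of t u] by linarith
  qed
  have A_A0: "A \<le> A0" using good(3) by (simp add: A_def)
  \<comment> \<open>The powers of \<open>l\<close> have exponents - \<alpha> (1 - \<alpha>) and (1 -
    \<alpha>) \<alpha> and cancel. What remains is 8 k
    \<open>\<mu>2 powr ((1 + \<alpha>) / 2)\<close>, and k = 3/2 \<mu>5 turns it into 3/4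
    \<open>H\<close>.\<close>
  have osc: "(2 * A) powr (1 - \<alpha>) * B powr \<alpha> \<le> 3 / 4 * H"
  proof -
    have "s powr (1 - \<alpha>) * (s\<^sup>2) powr \<alpha> = s powr (1 + \<alpha>)"
      using cpos by (simp add: powr_powr add.commute flip: powr_numeral powr_add)
    moreover have "s powr (1 + \<alpha>) = \<mu>2 powr ((1 + \<alpha>) / 2)"
      using \<mu> by (simp add: s_def powr_powr flip: powr_half_sqrt)
    moreover have "(l powr (-\<alpha>)) powr (1 - \<alpha>) * (l powr (1 - \<alpha>)) powr \<alpha> = 1"
      using l by (simp add: powr_powr flip: powr_add)
    moreover have "(8 * k) powr (1 - \<alpha>) * (8 * k) powr \<alpha> = 8 * k"
      using cpos by (simp flip: powr_add)
    moreover have "(2 * A) powr (1 - \<alpha>) * B powr \<alpha> =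
      ((8 * k) powr (1 - \<alpha>) * (8 * k) powr \<alpha>) * (s powr (1 - \<alpha>) * (s\<^sup>2) powr \<alpha>)
       * ((l powr (-\<alpha>)) powr (1 - \<alpha>) * (l powr (1 - \<alpha>)) powr \<alpha>)"
    proof -
      have "2 * A = (8 * k) * s * l powr (-\<alpha>)" "B = (8 * k) * s\<^sup>2 * l powr (1-\<alpha>)"
        by (simp_all add: A_def B_def)
      then show ?thesis using cpos by (simp only: powr_mult) (simp add: mult_ac)
    qed
    ultimately have "(2 * A) powr (1 - \<alpha>) * B powr \<alpha> = 8 * k * \<mu>2 powr ((1 + \<alpha>) / 2)" by simp
    also have "\<dots> = 3 / 4 * H" using \<mu> by (simp add: k_def \<mu>5)
    finally show ?thesis by simp
  qed
  have b2: "0 \<le> (b / l)\<^sup>2" "(b / l)\<^sup>2 \<le> r\<^sup>2"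
  proof -
    have "b / l \<le> r" using good(4) l by (simp add: divide_le_eq)
    moreover have "0 \<le> b / l" using l \<delta> by (simp add: b_def)
    ultimately show "(b / l)\<^sup>2 \<le> r\<^sup>2" by (intro power_mono)
  qed simp
  have coeff_close: "\<bar>coeff t - (\<psi> t)\<^sup>2\<bar> \<le> r\<^sup>2 + A0" for t
    using P_sup[of t] b2 A_A0 unfolding coeff_def by linarith
  have A0_le: "A0 \<le> \<kappa> / 2" "A0 \<le> \<epsilon> / 4" "2 * A0 \<le> (1 - \<theta>) * H * \<eta> powr \<alpha>"
    unfolding A0_def by linarith+
  \<comment> \<open>Members of \<open>PS\<close> vanish on the negative reals.\<close>
  define c where "c = (\<lambda>t. if 0 \<le> t then coeff t else 0)"
  show ?thesis
  proof (rule that[of i c sol sol'])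
    show "n \<le> i" by (rule i(1))
    show "c \<in> PS \<mu>1 \<mu>2 \<alpha> H"
    proof -
      have "\<mu>1 \<le> coeff t" "coeff t \<le> \<mu>2" for t
        using coeff_close[of t] psi2_range[of t] r(3) A0_le(1) by linarith+
      moreover have "\<bar>coeff t - coeff u\<bar> \<le> H * \<bar>t - u\<bar> powr \<alpha>" for t u
      proof -
        have "2 * A \<le> (1 - \<theta>) * H * \<eta> powr \<alpha>" using A0_le A_A0 by linarith
        then have "\<bar>((\<psi> t)\<^sup>2 + perturbation t) - ((\<psi> u)\<^sup>2 + perturbation u)\<bar> \<le> H * \<bar>t - u\<bar> powr \<alpha>"
          using \<alpha> H AB cpos \<eta> const_bounds
          by (intro holder_perturbation[where c = "\<lambda>t. (\<psi> t)\<^sup>2" and p = perturbation and t = t and u = u, OF _ _ _ _ _ _ _ psi2_holder psi2_lip P_sup P_sup P_lip osc]) auto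
        then show ?thesis by (simp add: coeff_def)
      qed
      ultimately show ?thesis by (simp add: PS_def c_def)
    qed
    have "\<bar>c0 t - c t\<bar> \<le> 7 / 8 * \<epsilon>" if "0 \<le> t" for t
    proof -
      have "\<bar>c0 t - coeff t\<bar> \<le> 7 / 8 * \<epsilon>"
        using coeff_close[of t] psi2_close[OF that] r(4) A0_le(2) by linarith
      then show ?thesis using that by (simp add: c_def)
    qed
    then have "udist c0 c \<le> 7 / 8 * \<epsilon>" by (rule udist_le)
    then show "udist c0 c < \<epsilon>" using \<epsilon> by linarith
    show "is_solution \<delta> \<sigma> c (lam i) sol sol'"
      unfolding l_def[symmetric] by (rule sol_is_solution) (simp_all add: b_def c_def)
    fix t assume t: "\<tau> \<le> t" "t \<le> T"
    have "K + M + b \<le> l / 2" using good(4,5) mult_right_mono[OF r(2), of l] l by linarith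
    then have "(K + M + b)\<^sup>2 \<le> (l / 2)\<^sup>2" using Kb M_nonneg by (intro power_mono) auto
    then have "(K + M + b)\<^sup>2 \<le> l\<^sup>2 / 2" using zero_le_power2[of l] unfolding power_divide by (simp only: power2_eq_square)
    from energy_lower[OF this, of t]
    have E: "D * exp (2 * K * J t) \<le> ((sol' t)\<^sup>2 + l\<^sup>2 * (sol t)\<^sup>2) * exp (2 * b * t)"
      by (simp add: D_def)
    define p where "p = l powr (1 - \<alpha>)"
    have "0 \<le> p" by (simp add: p_def)
    \<comment> \<open>Of the rate 3/2 \<mu>5, the normalisation consumes \<mu>5; the spare half
      beats the loss C / l once \<open>l\<close> is large.\<close>
    have "p * (\<mu>5 / 2 * \<tau> - C / l) \<le> p * (\<mu>5 / 2 * t - C / l)"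
      using t cpos \<open>0 \<le> p\<close> by (intro mult_left_mono) auto
    also have "\<dots> = 2 * K * (t / 2 - (1 + 2 * M * T) / (4 * m) / l) - \<mu>5 * p * t"
      by (simp add: K_def C_def k_def p_def algebra_simps)
    also have "\<dots> \<le> 2 * K * J t - \<mu>5 * p * t"
      using J_lower[of t T] t \<tau> cpos by (intro diff_right_mono mult_left_mono) (auto simp: K_def)
    finally have "Z \<le> D * exp (2 * K * J t - \<mu>5 * p * t)"
      using good(6) DC unfolding p_def[symmetric]
      by (smt (verit) exp_le_cancel_iff mult_left_mono)
    also have "\<dots> = D * exp (2 * K * J t) * exp (- \<mu>5 * p * t)" by (simp add: mult.assoc flip: exp_add)
    also have "\<dots> \<le> ((sol' t)\<^sup>2 + l\<^sup>2 * (sol t)\<^sup>2) * exp (2 * b * t) * exp (- \<mu>5 * p * t)"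
      by (intro mult_right_mono E) auto
    also have "\<dots> = ((sol' t)\<^sup>2 + l\<^sup>2 * (sol t)\<^sup>2) * exp (- \<mu>5 * p * t + 2 * b * t)"
      by (simp add: mult.assoc add.commute flip: exp_add)
    finally show "Z \<le> ((sol' t)\<^sup>2 + (lam i)\<^sup>2 * (sol t)\<^sup>2) *
       exp (- \<mu>5 * lam i powr (1 - \<alpha>) * t + 2 * \<delta> * lam i powr (2 * \<sigma>) * t)"
      by (simp add: p_def b_def l_def mult.assoc)
  qed
qed

theorem mainTheorem9:
  fixes \<mu>1 \<mu>2 \<alpha> H \<delta> \<sigma> :: real and lam :: "nat \<Rightarrow> real"
  assumes "0 < \<mu>1" "\<mu>1 < \<mu>2" "0 < \<alpha>" "\<alpha> < 1" "H > 0" "\<delta> \<ge> 0"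
    "0 < \<sigma>" "\<sigma> < 1/2"
    "\<forall>i. lam i > 0" "filterlim lam at_top sequentially"
  shows "residual_in (PS \<mu>1 \<mu>2 \<alpha> H)
    {c \<in> PS \<mu>1 \<mu>2 \<alpha> H. universal_activator \<alpha> \<delta> \<sigma> lam
        (\<mu>1 * min 1 \<mu>1 / (2 * \<mu>2\<^sup>2)) (H / (16 * \<mu>2 powr ((1 + \<alpha>) / 2))) c}"
proof -
  define X where "X = PS \<mu>1 \<mu>2 \<alpha> H"
  define \<mu>3 where "\<mu>3 = \<mu>1 * min 1 \<mu>1 / (2 * \<mu>2\<^sup>2)"
  define \<mu>5 where "\<mu>5 = H / (16 * \<mu>2 powr ((1 + \<alpha>) / 2))"
  define R where "R = (\<lambda>l w w' t. ((w' t)\<^sup>2 + l\<^sup>2 * (w t)\<^sup>2) *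
      exp (- \<mu>5 * l powr (1 - \<alpha>) * t + 2 * \<delta> * l powr (2 * \<sigma>) * t) :: real)"
  \<comment> \<open>Quantifying over all solution pairs avoids any appeal to existence. The window
    [1 / (n + 1), n + 1] excludes 0 and exhausts the positive reals, and \<open>Suc n\<close> avoids
    division by zero.\<close>
  define G where "G = (\<lambda>n. {c. \<exists>i\<ge>n. \<forall>w w'. is_solution \<delta> \<sigma> c (lam i) w w' \<longrightarrow>
      (\<forall>t. 1 / real (Suc n) \<le> t \<and> t \<le> real (Suc n) \<longrightarrow> \<mu>3 < R (lam i) w w' t)})"
  define U where "U = (\<lambda>n. {c \<in> X. \<exists>\<epsilon>>0. \<forall>d\<in>X. udist c d < \<epsilon> \<longrightarrow> d \<in> G n})"
  have \<mu>3: "0 < \<mu>3" "\<mu>3 \<le> 1"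
  proof -
    show "0 < \<mu>3" using assms by (simp add: \<mu>3_def)
    have "\<mu>1 * min 1 \<mu>1 \<le> \<mu>2 * \<mu>2" using assms by (intro mult_mono) auto
    also have "\<dots> \<le> 2 * \<mu>2\<^sup>2" by (simp add: power2_eq_square)
    finally show "\<mu>3 \<le> 1" using assms by (simp add: \<mu>3_def divide_le_eq_1)
  qed
  have "open_in_space X (U n)" for n unfolding U_def X_def by (rule open_interior_in_PS)
  moreover have "dense_in_space X (U n)" for n
    unfolding dense_in_space_def
  proof (intro conjI ballI allI impI)
    show "U n \<subseteq> X" by (auto simp: U_def)
    fix c0 and \<epsilon> :: real assume c0: "c0 \<in> X" and \<epsilon>: "0 < \<epsilon>"
    define T where "T = real (Suc n)"
    \<comment> \<open>The level 4 \<mu>3 leaves room for stability: from 4 \<mu>3 \<le> 2 R + \<mu>3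
      follows R > \<mu>3.\<close>
    have T: "0 < 1 / T" "1 / T \<le> T" "0 < 4 * \<mu>3" using \<mu>3 by (auto simp: T_def field_simps)
    obtain i c w w' where i: "n \<le> i" and c: "c \<in> X" "udist c0 c < \<epsilon>"
      and w: "is_solution \<delta> \<sigma> c (lam i) w w'"
      and big: "\<And>t. 1 / T \<le> t \<Longrightarrow> t \<le> T \<Longrightarrow> 4 * \<mu>3 \<le> R (lam i) w w' t"
      using activators_dense[OF assms(1-6,8-10) c0[unfolded X_def] \<epsilon> T \<mu>5_def, of n]
      unfolding R_def X_def by blast
    define l where "l = lam i"
    \<comment> \<open>After multiplication by the weight, whose growing factor is largest at
      \<open>T\<close>, the additive error is at most \<mu>3.\<close>
    define \<eta> where "\<eta> = \<mu>3 * exp (- 2 * \<delta> * l powr (2 * \<sigma>) * T)"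
    have "0 < \<eta>" using \<mu>3 by (simp add: \<eta>_def)
    from energy_stability[OF w assms(6) _ this, of \<mu>2 T] obtain r where r: "0 < r"
      and stable: "\<And>d v v' t. is_solution \<delta> \<sigma> d l v v' \<Longrightarrow> (\<And>t. 0 \<le> t \<Longrightarrow> \<bar>d t\<bar> \<le> \<mu>2) \<Longrightarrow>
        (\<And>t. 0 \<le> t \<Longrightarrow> \<bar>c t - d t\<bar> \<le> r) \<Longrightarrow> 0 \<le> t \<Longrightarrow> t \<le> T \<Longrightarrow>
        (w' t)\<^sup>2 + l\<^sup>2 * (w t)\<^sup>2 \<le> 2 * ((v' t)\<^sup>2 + l\<^sup>2 * (v t)\<^sup>2) + \<eta>"
      unfolding l_def using assms by (smt (verit))
    have "\<mu>3 < R l v v' t" if d: "d \<in> X" "udist c d < r" and v: "is_solution \<delta> \<sigma> d l v v'"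
      and t: "1 / T \<le> t" "t \<le> T" for d v v' t
    proof -
      define e where "e = exp (- \<mu>5 * l powr (1 - \<alpha>) * t + 2 * \<delta> * l powr (2 * \<sigma>) * t)"
      have t0: "0 \<le> t" using t T by linarith
      have cd: "\<bar>c t - d t\<bar> \<le> r" if "0 \<le> t" for t
        using le_udist[OF c(1)[unfolded X_def] d(1)[unfolded X_def] that] d(2) by linarith
      have d_bd: "\<bar>d t\<bar> \<le> \<mu>2" if "0 \<le> t" for t
      proof -
        have "\<mu>1 \<le> d t" "d t \<le> \<mu>2" using d(1) that by (auto simp: X_def PS_def)
        then show ?thesis using assms by linarith
      qed
      have "e \<le> exp (2 * \<delta> * l powr (2 * \<sigma>) * T)"
      proof -
        have "0 \<le> \<mu>5 * l powr (1 - \<alpha>) * t" using t0 assms by (simp add: \<mu>5_def)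
        moreover have "2 * \<delta> * l powr (2 * \<sigma>) * t \<le> 2 * \<delta> * l powr (2 * \<sigma>) * T"
          using t assms by (intro mult_left_mono) auto
        ultimately show ?thesis by (simp add: e_def)
      qed
      then have "\<eta> * e \<le> \<eta> * exp (2 * \<delta> * l powr (2 * \<sigma>) * T)"
        using \<open>0 < \<eta>\<close> by (intro mult_left_mono) auto
      also have "\<dots> = \<mu>3" by (simp add: \<eta>_def mult.assoc flip: exp_add)
      finally have \<eta>e: "\<eta> * e \<le> \<mu>3" .
      have "4 * \<mu>3 \<le> ((w' t)\<^sup>2 + l\<^sup>2 * (w t)\<^sup>2) * e"
        using big[OF t] by (simp add: R_def e_def l_def)
      also have "\<dots> \<le> (2 * ((v' t)\<^sup>2 + l\<^sup>2 * (v t)\<^sup>2) + \<eta>) * e"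
        using stable[OF v d_bd cd t0 t(2)] by (intro mult_right_mono) (auto simp: e_def)
      also have "\<dots> = 2 * R l v v' t + \<eta> * e" by (simp add: R_def e_def algebra_simps)
      finally show ?thesis using \<eta>e \<mu>3 by linarith
    qed
    then have "\<forall>d\<in>X. udist c d < r \<longrightarrow> d \<in> G n"
      using i unfolding G_def T_def l_def by blast
    then have "c \<in> U n" using c r by (auto simp: U_def)
    then show "\<exists>c'\<in>U n. udist c0 c' < \<epsilon>" using c by blast
  qed
  moreover have "(\<Inter>n. U n) \<subseteq> {c \<in> X. universal_activator \<alpha> \<delta> \<sigma> lam \<mu>3 \<mu>5 c}"
  proof
    fix c assume c: "c \<in> (\<Inter>n. U n)"
    then have cX: "c \<in> X" by (auto simp: U_def)
    have cG: "c \<in> G n" for n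
    proof -
      obtain \<epsilon> where "0 < \<epsilon>" "\<forall>d\<in>X. udist c d < \<epsilon> \<longrightarrow> d \<in> G n" using c by (auto simp: U_def)
      moreover have "udist c c \<le> 0" by (rule udist_le) simp
      ultimately show ?thesis using cX by auto
    qed
    have "universal_activator \<alpha> \<delta> \<sigma> lam \<mu>3 \<mu>5 c"
      unfolding universal_activator_def
    proof (intro conjI allI impI)
      show "continuous_on {0..} c"
        by (rule holder_imp_continuous_on[OF assms(3), where H = H]) (use cX in \<open>auto simp: X_def PS_def\<close>)
      fix w w' and t :: real
      assume w: "\<forall>i. is_solution \<delta> \<sigma> c (lam i) (w i) (w' i)" and t: "0 \<le> t"
      have "\<exists>\<^sub>F i in sequentially. \<mu>3 \<le> R (lam i) (w i) (w' i) t"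
      \<comment> \<open>At time 0 the initial data give normalised energy 1, so \<mu>3 \<le> 1
        suffices there.\<close>
      proof (cases "t = 0")
        case True
        have "R (lam i) (w i) (w' i) t = 1" for i using w by (simp add: R_def True is_solution_def)
        then show ?thesis using \<mu>3 by simp
      next
        case False
        show ?thesis
          unfolding frequently_sequentially
        proof
          fix N
          \<comment> \<open>One \<open>n\<close> puts \<open>t\<close> into the window of
            \<open>G n\<close> and makes the index supplied by \<open>G n\<close> at least
            \<open>N\<close>.\<close>
          obtain n where n: "max (real N) (max t (1 / t)) \<le> real n" using real_arch_simple by blast
          have "1 / real (Suc n) \<le> t"
          proof -
            have "1 / t \<le> real (Suc n)" using n by simp
            then show ?thesis using t False by (simp add: field_simps)
          qed
          moreover have "t \<le> real (Suc n)" using n by simp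
          moreover have "N \<le> n" using n by simp
          ultimately show "\<exists>i\<ge>N. \<mu>3 \<le> R (lam i) (w i) (w' i) t"
            using cG[of n] w unfolding G_def by (auto intro: less_imp_le) (meson le_trans less_imp_le)
        qed
      qed
      then show "ereal \<mu>3 \<le> Limsup sequentially (\<lambda>i. ereal ((\<bar>w' i t\<bar>\<^sup>2 + (lam i)\<^sup>2 * \<bar>w i t\<bar>\<^sup>2) *
           exp (- \<mu>5 * lam i powr (1 - \<alpha>) * t + 2 * \<delta> * lam i powr (2 * \<sigma>) * t)))"
        unfolding R_def power2_abs
        by (intro le_Limsup_frequently) simp
    qed
    then show "c \<in> {c \<in> X. universal_activator \<alpha> \<delta> \<sigma> lam \<mu>3 \<mu>5 c}" using cX by simp
  qed
  ultimately show ?thesis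
    unfolding residual_in_def X_def \<mu>3_def \<mu>5_def by blast
qed

end
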